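(* Let $d\le 5$ be a positive integer, let $G=(V,E)$ be a finite graph and let $H=(V,F)$ be a maximal $d$-sparse spanning subgraph of $G$ (that is, $H$ is $d$-sparse and $H+e$ is not $d$-sparse for every $e\in E\setminus F$). Then $r_d(G)\le |F|$.
   Context: For a graph $G=(V,E)$ and $X\subseteq V$, $i_G(X)$ denotes the number of edges of $G$ with both ends in $X$. A graph $G=(V,E)$ is $d$-sparse if $i_G(X)\le d|X|-\binom{d+1}{2}$ for every $X\subseteq V$ with $|X|\ge d$. For $p:V\to\mathbb{R}^d$, the rigidity matrix $R(G,p)$ is the $|E|\times d|V|$ matrix whose row indexed by the edge $uv$ has the vector $p(u)-p(v)$ in the $d$ columns of $u$, the vector $p(v)-p(u)$ in the $d$ columns of $v$, and zeros elsewhere. $r_d(G)$ denotes the rank of $R(G,p)$ for a generic $p$ (equivalently, the maximum rank of $R(G,p)$ over all $p:V\to\mathbb{R}^d$), i.e. the rank of the $d$-dimensional generic rigidity matroid of $G$. *)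

theory Defs
  imports "HOL-Analysis.Analysis" "HOL-Library.Function_Algebras"
begin

definition simple_graph :: "'a set \<Rightarrow> 'a set set \<Rightarrow> bool" where
  "simple_graph V E \<longleftrightarrow> E \<subseteq> {e. e \<subseteq> V \<and> card e = 2}"

definition induced_edge_count :: "'a set set \<Rightarrow> 'a set \<Rightarrow> nat" where
  "induced_edge_count E X = card {e \<in> E. e \<subseteq> X}"

definition sparse :: "nat \<Rightarrow> 'a set \<Rightarrow> 'a set set \<Rightarrow> bool" where
  "sparse d V E \<longleftrightarrow>
     (\<forall>X \<subseteq> V. d \<le> card X \<longrightarrow>
        int (induced_edge_count E X) \<le> int d * int (card X) - int ((d + 1) choose 2))"

definition maximal_sparse_subgraph :: "nat \<Rightarrow> 'a set \<Rightarrow> 'a set set \<Rightarrow> 'a set set \<Rightarrow> bool" where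
  "maximal_sparse_subgraph d V E F \<longleftrightarrow>
     F \<subseteq> E \<and> sparse d V F \<and> (\<forall>e \<in> E - F. \<not> sparse d V (insert e F))"

(* Matrices have arbitrary sets as row and column index sets (I and J): a matrix is a function
   of a row index and a column index, of which only the entries in I \<times> J matter. *)

abbreviation fun_scale :: "real \<Rightarrow> ('c \<Rightarrow> real) \<Rightarrow> ('c \<Rightarrow> real)" where
  "fun_scale c f \<equiv> (\<lambda>j. c * f j)"

definition matrix_row :: "'c set \<Rightarrow> ('r \<Rightarrow> 'c \<Rightarrow> real) \<Rightarrow> 'r \<Rightarrow> ('c \<Rightarrow> real)" where
  "matrix_row J A i = (\<lambda>j. if j \<in> J then A i j else 0)"

(* As for rank in HOL-Analysis, the dimension of the space spanned by the rows. *)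
definition matrix_rank :: "'r set \<Rightarrow> 'c set \<Rightarrow> ('r \<Rightarrow> 'c \<Rightarrow> real) \<Rightarrow> nat" where
  "matrix_rank I J A = vector_space.dim fun_scale (matrix_row J A ` I)"

(* Column (w, k) is the k-th of the d columns of the vertex w, where k < d. For w in the edge e,
   the other end of e is the element of e - {w}. A map p from V to d-dimensional space is
   a function of a vertex and a coordinate k < d; other values of p are irrelevant. *)
definition rigidity_matrix :: "('a \<Rightarrow> nat \<Rightarrow> real) \<Rightarrow> 'a set \<Rightarrow> 'a \<times> nat \<Rightarrow> real" where
  "rigidity_matrix p e = (\<lambda>(w, k). if w \<in> e then p w k - p (the_elem (e - {w})) k else 0)"

definition framework_rank :: "nat \<Rightarrow> 'a set \<Rightarrow> 'a set set \<Rightarrow> ('a \<Rightarrow> nat \<Rightarrow> real) \<Rightarrow> nat" where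
  "framework_rank d V E p = matrix_rank E (V \<times> {..<d}) (rigidity_matrix p)"

(* The generic rank, as the maximum over all p; see framework_rank_finite for the existence
   of the maximum. *)
definition rigidity_rank :: "nat \<Rightarrow> 'a set \<Rightarrow> 'a set set \<Rightarrow> nat" where
  "rigidity_rank d V E = Max (range (framework_rank d V E))"

lemma rigidity_matrix_edge:
  assumes "u \<noteq> v"
  shows "rigidity_matrix p {u, v} (w, k) =
    (if w = u then p u k - p v k else if w = v then p v k - p u k else 0)"
proof -
  have "{u, v} - {u} = {v}" "{u, v} - {v} = {u}" using assms by auto
  then show ?thesis using assms by (auto simp: rigidity_matrix_def)
qed

lemma vector_space_fun_scale: "vector_space (fun_scale :: real \<Rightarrow> ('c \<Rightarrow> real) \<Rightarrow> _)"
  by unfold_locales (auto simp: algebra_simps)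

lemma matrix_rank_le_card:
  assumes "finite I"
  shows "matrix_rank I J A \<le> card I"
proof -
  interpret vector_space "fun_scale :: real \<Rightarrow> ('c \<Rightarrow> real) \<Rightarrow> _"
    by (rule vector_space_fun_scale)
  have "dim (matrix_row J A ` I) \<le> card (matrix_row J A ` I)"
    using assms by (intro dim_le_card) (auto intro: span_base)
  also have "\<dots> \<le> card I" using assms by (rule card_image_le)
  finally show ?thesis unfolding matrix_rank_def .
qed

lemma framework_rank_finite:
  assumes "finite V" "simple_graph V E"
  shows "finite (range (framework_rank d V E))"
proof -
  have "E \<subseteq> Pow V" using assms(2) by (auto simp: simple_graph_def)
  then have "finite E" using assms(1) by (simp add: finite_subset)
  then have "range (framework_rank d V E) \<subseteq> {..card E}"
    by (auto simp: framework_rank_def intro: matrix_rank_le_card)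
  then show ?thesis by (rule finite_subset) simp
qed

lemma rigidity_rank_attained:
  assumes "finite V" "simple_graph V E"
  shows "\<exists>p. framework_rank d V E p = rigidity_rank d V E"
  using Max_in[OF framework_rank_finite[OF assms]]
  by (metis empty_not_UNIV image_is_empty rangeE rigidity_rank_def)

lemma framework_rank_le_rigidity_rank:
  assumes "finite V" "simple_graph V E"
  shows "framework_rank d V E p \<le> rigidity_rank d V E"
  unfolding rigidity_rank_def by (intro Max_ge framework_rank_finite[OF assms]) simp

end

theory Submission
  imports Defs
begin

text \<open>The maximal critical sets of F (those attaining the sparsity bound) cover E - F and pairwise
  meet in fewer than d vertices. Replace each of them by a complete graph. At a p in general
  position such a graph on X has rank at most the number of edges of F inside X, so it suffices to
  order the sets in such a way that the edges of F shared by X with the earlier sets are always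
  independent. They are if they form a d-degenerate graph.

  If no set of some subfamily could come last, then inside every member X the shared edges would
  have a core C of minimum degree at least d + 1. Sparsity of the union of the members bounds
  the total overcount of vertices and edges from above; distributing this overcount equally among
  the members that contain a vertex or edge, and using sparsity of C, bounds it from below. The two
  bounds contradict each other, because every vertex of a core makes a nonnegative contribution,
  except when d = 5 and the vertex lies in exactly three members. The loss of 1/6 is then
  compensated by the other two members, in whose cores the vertex cannot lie.\<close>

section \<open>Linear algebra in function spaces\<close>

text \<open>For d = 3, two copies of K5 glued along an edge that is then deleted are sparse and
  critical, yet dependent. So \<open>F\<close> serves mainly as a count: a member has as many edges
  of \<open>F\<close> as the bound for the rank of the complete graph on it. Adding these numbers
  counts shared edges repeatedly, and they may be discounted only if together they extend to a basis
  of the complete graph. Hence they must be independent, and degeneracy turns this into a counting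
  problem. With m members and b = (d + 1) choose 2, the upper bound is (m - 1) b, since m critical
  sets are weighed against one union, while sparsity of m cores yields m b. The contradiction thus
  only needs local corrections with nonnegative sum. The range of d comes from there: the reciprocal
  multiplicities of the shared edges at a core vertex in c other members should sum to at least 2 d
  / (c + 1).\<close>

interpretation fun_space: vector_space "fun_scale :: real \<Rightarrow> ('c \<Rightarrow> real) \<Rightarrow> 'c \<Rightarrow> real"
  by (rule vector_space_fun_scale)

interpretation real_space: vector_space "(*) :: real \<Rightarrow> real \<Rightarrow> real"
  by unfold_locales (auto simp: algebra_simps)

interpretation fun_real_pair: vector_space_pair
  "fun_scale :: real \<Rightarrow> ('c \<Rightarrow> real) \<Rightarrow> 'c \<Rightarrow> real" "(*) :: real \<Rightarrow> real \<Rightarrow> real" ..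

lemma sum_fun_apply: "(\<Sum>i\<in>I. f i) x = (\<Sum>i\<in>I. (f i x :: real))"
  by (induction I rule: infinite_finite_induct) auto

text \<open>Indexed by edges rather than stated for a set of rows: the rows change with
  \<open>p\<close>, while coefficients stay attached to edges.\<close>

definition lin_indep :: "'i set \<Rightarrow> ('i \<Rightarrow> 'c \<Rightarrow> real) \<Rightarrow> bool" where
  "lin_indep I f \<longleftrightarrow> (\<forall>c. (\<Sum>i\<in>I. fun_scale (c i) (f i)) = 0 \<longrightarrow> (\<forall>i\<in>I. c i = 0))"

lemma lin_indep_iff:
  assumes "finite I"
  shows "lin_indep I f \<longleftrightarrow> inj_on f I \<and> fun_space.independent (f ` I)"
proof
  assume L: "lin_indep I f"
  have inj: "inj_on f I"
  proof (rule inj_onI, rule ccontr)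
    fix i j assume ij: "i \<in> I" "j \<in> I" "f i = f j" "i \<noteq> j"
    define c where "c = (\<lambda>l. if l = i then 1 else if l = j then - 1 else (0::real))"
    have "(\<Sum>l\<in>I. fun_scale (c l) (f l)) = (\<Sum>l\<in>{i, j}. fun_scale (c l) (f l))"
      by (rule sum.mono_neutral_right) (use assms ij in \<open>auto simp: c_def\<close>)
    also have "\<dots> = 0" using ij by (auto simp: c_def)
    finally have "c i = 0" using L ij(1) by (auto simp: lin_indep_def)
    then show False by (simp add: c_def)
  qed
  moreover have "fun_space.independent (f ` I)"
  proof
    assume "fun_space.dependent (f ` I)"
    then obtain u v where "v \<in> f ` I" "u v \<noteq> 0" "(\<Sum>v\<in>f ` I. fun_scale (u v) v) = 0"
      using fun_space.dependent_finite[of "f ` I"] assms by auto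
    then show False using L inj by (auto simp: sum.reindex lin_indep_def)
  qed
  ultimately show "inj_on f I \<and> fun_space.independent (f ` I)" ..
next
  assume R: "inj_on f I \<and> fun_space.independent (f ` I)"
  show "lin_indep I f" unfolding lin_indep_def
  proof (intro allI impI ballI, rule ccontr)
    fix c i assume c: "(\<Sum>i\<in>I. fun_scale (c i) (f i)) = 0" "i \<in> I" "c i \<noteq> 0"
    define u where "u = c \<circ> the_inv_into I f"
    have u: "u (f j) = c j" if "j \<in> I" for j
      using R that by (simp add: u_def the_inv_into_f_f)
    have "(\<Sum>v\<in>f ` I. fun_scale (u v) v) = (\<Sum>j\<in>I. fun_scale (u (f j)) (f j))"
      using R by (simp add: sum.reindex)
    also have "\<dots> = (\<Sum>j\<in>I. fun_scale (c j) (f j))" by (intro sum.cong refl) (simp add: u)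
    also have "\<dots> = 0" by (rule c)
    finally have "(\<Sum>v\<in>f ` I. fun_scale (u v) v) = 0" .
    moreover have "u (f i) \<noteq> 0" "f i \<in> f ` I" using c u by auto
    ultimately have "fun_space.dependent (f ` I)"
      unfolding fun_space.dependent_finite[OF finite_imageI[OF assms]] by blast
    then show False using R by blast
  qed
qed

lemma card_le_if_lin_indep:
  assumes "finite I" "lin_indep I f" "finite T" "f ` I \<subseteq> fun_space.span T"
  shows "card I \<le> card T"
proof -
  have "inj_on f I" "fun_space.independent (f ` I)"
    using assms(2) lin_indep_iff[OF assms(1), of f] by blast+
  then show ?thesis
    using fun_space.independent_span_bound[OF assms(3) _ assms(4)] card_image[of f I] by simp
qed

lemma lin_indep_dual:
  assumes "finite I" "lin_indep I f" "i \<in> I"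
  shows "\<exists>\<phi>. Vector_Spaces.linear fun_scale (*) \<phi> \<and> (\<forall>j\<in>I. \<phi> (f j) = (if j = i then 1 else 0))"
proof -
  have "inj_on f I" "fun_space.independent (f ` I)" using assms lin_indep_iff by auto
  then obtain \<phi> where \<phi>: "Vector_Spaces.linear fun_scale (*) \<phi>"
      "\<forall>x\<in>f ` I. \<phi> x = (if x = f i then 1 else 0)"
    using fun_real_pair.linear_independent_extend[of "f ` I" "\<lambda>x. if x = f i then 1 else 0"] by blast
  then show ?thesis using \<open>inj_on f I\<close> assms(3) by (intro exI[of _ \<phi>]) (auto simp: inj_on_eq_iff)
qed

text \<open>Applying dual functionals to a dependency of the perturbed family bounds each coefficient
  by a small multiple of the sum of all coefficients.\<close>

lemma lin_indep_perturb:
  fixes f :: "'i \<Rightarrow> 'c \<Rightarrow> real" and D :: "'i \<Rightarrow> 'k \<Rightarrow> 'c \<Rightarrow> real" and a :: "real \<Rightarrow> 'k \<Rightarrow> real"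
  assumes fin: "finite I" and L: "lin_indep I f" and K: "finite K"
    and a: "\<And>s l. 0 < s \<Longrightarrow> s \<le> 1 \<Longrightarrow> l \<in> K \<Longrightarrow> \<bar>a s l\<bar> \<le> s"
  shows "\<exists>\<epsilon>>0. \<forall>s. 0 < s \<and> s < \<epsilon> \<longrightarrow> lin_indep I (\<lambda>i. f i + (\<Sum>l\<in>K. fun_scale (a s l) (D i l)))"
proof -
  obtain \<phi> where lin: "\<And>i. i \<in> I \<Longrightarrow> Vector_Spaces.linear fun_scale (*) (\<phi> i)"
      and dual: "\<And>i j. i \<in> I \<Longrightarrow> j \<in> I \<Longrightarrow> \<phi> i (f j) = (if j = i then 1 else (0::real))"
    using lin_indep_dual[OF fin L] by metis
  have add: "\<phi> i (x + y) = \<phi> i x + \<phi> i y" and scale: "\<phi> i (fun_scale r x) = r * \<phi> i x"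
    and sum: "\<phi> i (sum g B) = (\<Sum>b\<in>B. \<phi> i (g b))"
    if "i \<in> I" for i x y r and g :: "'b \<Rightarrow> 'c \<Rightarrow> real" and B
    using fun_real_pair.linear_add[OF lin[OF that]] fun_real_pair.linear_scale[OF lin[OF that]]
      fun_real_pair.linear_sum[OF lin[OF that], of g B] by auto
  have zero: "\<phi> i 0 = 0" if "i \<in> I" for i using sum[OF that, of "\<lambda>_. 0" "{}"] by simp
  define M where "M = (\<Sum>i\<in>I. \<Sum>j\<in>I. \<Sum>l\<in>K. \<bar>\<phi> i (D j l)\<bar>)"
  have M: "M \<ge> 0" unfolding M_def by (intro sum_nonneg) auto
  \<comment> \<open>The sum \<open>S\<close> of the absolute coefficients will satisfy S \<le> M s
    S, so M s < 1 forces S = 0. The added 1 covers M = 0 and gives \<epsilon> \<le> 1, the range in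
    which \<open>a\<close> is controlled.\<close>
  define \<epsilon> where "\<epsilon> = 1 / (M + 1)"
  have "\<epsilon> > 0" "\<epsilon> \<le> 1" using M by (auto simp: \<epsilon>_def)
  moreover have "lin_indep I (\<lambda>i. f i + (\<Sum>l\<in>K. fun_scale (a s l) (D i l)))"
    if s: "0 < s" "s < \<epsilon>" for s
    unfolding lin_indep_def
  proof (intro allI impI)
    fix c assume c: "(\<Sum>j\<in>I. fun_scale (c j) (f j + (\<Sum>l\<in>K. fun_scale (a s l) (D j l)))) = 0"
    define S where "S = (\<Sum>j\<in>I. \<bar>c j\<bar>)"
    have S0: "S \<ge> 0" unfolding S_def by (intro sum_nonneg) auto
    have bound: "\<bar>c i\<bar> \<le> (\<Sum>j\<in>I. \<Sum>l\<in>K. \<bar>\<phi> i (D j l)\<bar>) * (s * S)" if i: "i \<in> I" for i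
    proof -
      have "0 = \<phi> i (\<Sum>j\<in>I. fun_scale (c j) (f j + (\<Sum>l\<in>K. fun_scale (a s l) (D j l))))"
        unfolding c using zero[OF i] by simp
      also have "\<dots> = (\<Sum>j\<in>I. c j * \<phi> i (f j)) + (\<Sum>j\<in>I. c j * (\<Sum>l\<in>K. a s l * \<phi> i (D j l)))"
        by (simp only: sum[OF i] scale[OF i] add[OF i] distrib_left sum.distrib)
      also have "(\<Sum>j\<in>I. c j * \<phi> i (f j)) = (\<Sum>j\<in>I. if j = i then c j else 0)"
        by (intro sum.cong refl) (simp add: dual i)
      also have "\<dots> = c i" using fin i by simp
      finally have "\<bar>c i\<bar> = \<bar>\<Sum>j\<in>I. \<Sum>l\<in>K. c j * (a s l * \<phi> i (D j l))\<bar>"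
        by (simp add: sum_distrib_left)
      also have "\<dots> \<le> (\<Sum>j\<in>I. \<Sum>l\<in>K. \<bar>c j * (a s l * \<phi> i (D j l))\<bar>)"
        by (rule order_trans[OF sum_abs sum_mono[OF sum_abs]])
      also have "\<dots> \<le> (\<Sum>j\<in>I. \<Sum>l\<in>K. \<bar>\<phi> i (D j l)\<bar> * (s * S))"
      proof (intro sum_mono)
        fix j l assume j: "j \<in> I" and l: "l \<in> K"
        have "\<bar>c j\<bar> \<le> S" unfolding S_def by (rule member_le_sum) (use j fin in auto)
        moreover have "\<bar>a s l\<bar> \<le> s" using a s l \<open>\<epsilon> \<le> 1\<close> by simp
        ultimately have "\<bar>c j\<bar> * \<bar>a s l\<bar> \<le> S * s" using S0 by (intro mult_mono) auto
        then have "\<bar>c j\<bar> * \<bar>a s l\<bar> * \<bar>\<phi> i (D j l)\<bar> \<le> S * s * \<bar>\<phi> i (D j l)\<bar>"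
          by (rule mult_right_mono) simp
        then show "\<bar>c j * (a s l * \<phi> i (D j l))\<bar> \<le> \<bar>\<phi> i (D j l)\<bar> * (s * S)"
          by (simp add: abs_mult mult_ac)
      qed
      finally show ?thesis by (simp add: sum_distrib_right)
    qed
    have "S \<le> (\<Sum>i\<in>I. (\<Sum>j\<in>I. \<Sum>l\<in>K. \<bar>\<phi> i (D j l)\<bar>) * (s * S))"
      unfolding S_def by (rule sum_mono) (use bound in \<open>simp add: S_def\<close>)
    also have "\<dots> = M * s * S" by (simp add: M_def sum_distrib_right mult.assoc)
    finally have "S * (1 - M * s) \<le> 0" by (simp add: algebra_simps)
    moreover have "M * s < 1"
    proof -
      have "M * s \<le> M * \<epsilon>" using s M by (intro mult_left_mono) auto
      also have "\<dots> < 1" using M by (simp add: \<epsilon>_def)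
      finally show ?thesis .
    qed
    ultimately have "S \<le> 0" using mult_le_0_iff[of S "1 - M * s"] by auto
    then have "S = 0" using S0 by simp
    then show "\<forall>i\<in>I. c i = 0" unfolding S_def using fin by (simp add: sum_nonneg_eq_0_iff)
  qed
  ultimately show ?thesis by blast
qed

text \<open>The columns of \<open>A\<close> lie in the span of \<open>card I\<close> unit vectors,
  hence are dependent; a dependency is a solution.\<close>

lemma homogeneous_system_solvable:
  fixes A :: "'i \<Rightarrow> 'j \<Rightarrow> real"
  assumes "finite I" "finite J" "card I < card J"
  shows "\<exists>x. (\<exists>j\<in>J. x j \<noteq> 0) \<and> (\<forall>i\<in>I. (\<Sum>j\<in>J. A i j * x j) = 0)"
proof (rule ccontr)
  assume neg: "\<not> ?thesis"
  define f where "f = (\<lambda>j i. if i \<in> I then A i j else 0)"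
  define e where "e = (\<lambda>(i::'i) i'. if i' = i then 1 else (0::real))"
  have "lin_indep J f" unfolding lin_indep_def
  proof (intro allI impI)
    fix c assume c: "(\<Sum>j\<in>J. fun_scale (c j) (f j)) = 0"
    have "(\<Sum>j\<in>J. A i j * c j) = 0" if "i \<in> I" for i
      using fun_cong[OF c, of i] that by (simp add: sum_fun_apply f_def mult.commute)
    then show "\<forall>j\<in>J. c j = 0" using neg by blast
  qed
  moreover have "f ` J \<subseteq> fun_space.span (e ` I)"
  proof
    fix g assume "g \<in> f ` J"
    then obtain j where g: "g = f j" by auto
    have "g = (\<Sum>i\<in>I. fun_scale (A i j) (e i))"
      using assms(1) by (auto simp: g fun_eq_iff sum_fun_apply f_def e_def if_distrib cong: if_cong)
    also have "\<dots> \<in> fun_space.span (e ` I)"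
      by (intro fun_space.span_sum fun_space.span_scale fun_space.span_base) auto
    finally show "g \<in> fun_space.span (e ` I)" .
  qed
  ultimately have "card J \<le> card (e ` I)" using assms by (intro card_le_if_lin_indep) auto
  then show False using card_image_le[OF assms(1), of e] assms(3) by simp
qed

section \<open>Frameworks in general position\<close>

abbreviation edge_row :: "nat \<Rightarrow> 'a set \<Rightarrow> ('a \<Rightarrow> nat \<Rightarrow> real) \<Rightarrow> 'a set \<Rightarrow> 'a \<times> nat \<Rightarrow> real" where
  "edge_row d V p \<equiv> matrix_row (V \<times> {..<d}) (rigidity_matrix p)"

text \<open>Affine independence of any d + 1 points, in the coefficient form in which stresses at a
  vertex and affine dependencies arrive.\<close>

definition general_position :: "nat \<Rightarrow> ('a \<Rightarrow> nat \<Rightarrow> real) \<Rightarrow> 'a set \<Rightarrow> bool" where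
  "general_position d p V \<longleftrightarrow> (\<forall>W c. W \<subseteq> V \<longrightarrow> card W \<le> d + 1 \<longrightarrow> (\<Sum>u\<in>W. c u) = 0 \<longrightarrow>
     (\<forall>i<d. (\<Sum>u\<in>W. c u * p u i) = 0) \<longrightarrow> (\<forall>u\<in>W. c u = 0))"

lemma general_positionD:
  assumes "general_position d p V" "W \<subseteq> V" "card W \<le> d + 1" "(\<Sum>u\<in>W. c u) = 0"
    and "\<And>i. i < d \<Longrightarrow> (\<Sum>u\<in>W. c u * p u i) = 0" "u \<in> W"
  shows "c u = 0"
  using assms unfolding general_position_def by blast

text \<open>Rows are linear in \<open>p\<close>, so shifting one vertex adds a combination of fixed
  rows, the shape that \<open>lin_indep_perturb\<close> handles.\<close>

lemma edge_row_translate: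
  "edge_row d V (\<lambda>w i. p w i + (if w = v then a i else 0)) e
    = edge_row d V p e + (\<Sum>l<d. fun_scale (a l) (edge_row d V (\<lambda>w i. if w = v \<and> i = l then 1 else 0) e))"
proof
  fix x :: "'a \<times> nat"
  obtain w i where x: "x = (w, i)" by fastforce
  have *: "(\<Sum>l<d. a l * ((if P \<and> i = l then 1 else 0) - (if Q \<and> i = l then 1 else 0)))
      = (if P then a i else 0) - (if Q then a i else 0)" if "i < d" for P Q
  proof -
    have "(\<Sum>l<d. a l * ((if P \<and> i = l then 1 else 0) - (if Q \<and> i = l then 1 else 0)))
        = (\<Sum>l<d. if l = i then (if P then a i else 0) - (if Q then a i else 0) else 0)"
      by (intro sum.cong refl) auto
    then show ?thesis using that by simp
  qed
  show "edge_row d V (\<lambda>w i. p w i + (if w = v then a i else 0)) e x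
    = (edge_row d V p e + (\<Sum>l<d. fun_scale (a l) (edge_row d V (\<lambda>w i. if w = v \<and> i = l then 1 else 0) e))) x"
  proof (cases "w \<in> V \<and> i < d \<and> w \<in> e")
    case True
    then show ?thesis
      using *[of "w = v" "the_elem (e - {w}) = v"]
      by (simp add: x sum_fun_apply matrix_row_def rigidity_matrix_def)
  next
    case False
    then show ?thesis by (auto simp: x sum_fun_apply matrix_row_def rigidity_matrix_def)
  qed
qed

text \<open>The moment curve meets every affine hyperplane in finitely many points.\<close>

lemma finite_affine_hull_moment_curve:
  fixes p :: "'a \<Rightarrow> nat \<Rightarrow> real" and q :: "nat \<Rightarrow> real"
  assumes W: "finite W" "W \<noteq> {}" "card W \<le> d"
  shows "finite {s. \<exists>c. (\<Sum>u\<in>W. c u) = 1 \<and> (\<forall>i<d. (\<Sum>u\<in>W. c u * p u i) = q i + s ^ Suc i)}"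
proof -
  \<comment> \<open>A nonzero affine functional vanishing on the points of \<open>W\<close>, with
    constant term given by \<open>x d\<close>: at most d equations in d + 1 unknowns.\<close>
  obtain x :: "nat \<Rightarrow> real" where x: "\<exists>j\<in>{..d}. x j \<noteq> 0"
      "\<forall>u\<in>W. (\<Sum>j\<in>{..d}. (if j < d then p u j else - 1) * x j) = 0"
    using homogeneous_system_solvable[of W "{..d}" "\<lambda>u j. if j < d then p u j else - 1"] W by auto
  have hyp: "(\<Sum>i<d. x i * p u i) = x d" if "u \<in> W" for u
  proof -
    have "(\<Sum>j\<in>{..d}. (if j < d then p u j else - 1) * x j) = (\<Sum>i<d. x i * p u i) - x d"
      by (simp add: lessThan_Suc_atMost[symmetric] mult.commute)
    then show ?thesis using x(2) that by simp
  qed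
  obtain u0 where "u0 \<in> W" using W by blast
  have "\<exists>i<d. x i \<noteq> 0"
  proof (rule ccontr)
    assume "\<not> ?thesis"
    then have z: "\<forall>i<d. x i = 0" by blast
    then have "x d = 0" using hyp[OF \<open>u0 \<in> W\<close>] by simp
    then show False using x(1) z by (metis atMost_iff le_neq_implies_less)
  qed
  then obtain i0 where i0: "i0 < d" "x i0 \<noteq> 0" by blast
  \<comment> \<open>Coefficients of the functional along the curve. The curve starts with the first
    power of s, so \<open>x i\<close> belongs to the power i + 1, and a nonzero \<open>x i0\<close>
    makes the polynomial nonzero whatever its constant term.\<close>
  define b where "b = (\<lambda>i. case i of 0 \<Rightarrow> (\<Sum>i<d. x i * q i) - x d | Suc j \<Rightarrow> x j)"
  have "finite {s. (\<Sum>i\<le>d. b i * s ^ i) = 0}"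
    by (rule polyfun_finite_roots[THEN iffD2]) (use i0 in \<open>auto simp: b_def intro!: exI[of _ "Suc i0"]\<close>)
  moreover have "{s. \<exists>c. (\<Sum>u\<in>W. c u) = 1 \<and> (\<forall>i<d. (\<Sum>u\<in>W. c u * p u i) = q i + s ^ Suc i)}
      \<subseteq> {s. (\<Sum>i\<le>d. b i * s ^ i) = 0}"
  proof clarify
    fix s c assume c: "(\<Sum>u\<in>W. c u) = 1" "\<forall>i<d. (\<Sum>u\<in>W. c u * p u i) = q i + s ^ Suc i"
    have "(\<Sum>i<d. x i * (q i + s ^ Suc i)) = (\<Sum>i<d. x i * (\<Sum>u\<in>W. c u * p u i))"
      using c(2) by (intro sum.cong refl) simp
    also have "\<dots> = (\<Sum>i<d. \<Sum>u\<in>W. c u * (x i * p u i))"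
      by (simp add: sum_distrib_left mult_ac)
    also have "\<dots> = (\<Sum>u\<in>W. \<Sum>i<d. c u * (x i * p u i))" by (rule sum.swap)
    also have "\<dots> = (\<Sum>u\<in>W. c u * x d)"
      by (intro sum.cong refl) (simp add: hyp sum_distrib_left[symmetric])
    also have "\<dots> = x d" using c(1) by (simp add: sum_distrib_right[symmetric])
    finally have "(\<Sum>i<d. x i * q i) + (\<Sum>i<d. x i * s ^ Suc i) = x d"
      by (simp add: distrib_left sum.distrib)
    moreover have "(\<Sum>i\<le>d. b i * s ^ i) = b 0 + (\<Sum>i<d. b (Suc i) * s ^ Suc i)"
      by (simp add: sum.atMost_shift)
    ultimately show "(\<Sum>i\<le>d. b i * s ^ i) = 0" by (simp add: b_def)
  qed
  ultimately show ?thesis by (rule finite_subset[rotated])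
qed

text \<open>Vertices are moved one at a time along a short piece of moment curve: the given rows
  stay independent for all small s, and only finitely many s put the vertex into the affine hull of
  at most d earlier ones.\<close>

lemma exists_general_position:
  assumes fV: "finite V" and fE: "finite E" and L: "lin_indep E (edge_row d V p\<^sub>0)"
  shows "\<exists>p. general_position d p V \<and> lin_indep E (edge_row d V p)"
proof -
  have "\<exists>p. general_position d p U \<and> lin_indep E (edge_row d V p)" if "finite U" for U
    using that
  proof (induction U)
    case empty
    show ?case using L by (intro exI[of _ p\<^sub>0]) (auto simp: general_position_def)
  next
    case (insert v U)
    then obtain p where p: "general_position d p U" "lin_indep E (edge_row d V p)" by blast
    let ?p = "\<lambda>s w i. p w i + (if w = v then s ^ Suc i else 0)"
    have "\<exists>\<epsilon>>0. \<forall>s. 0 < s \<and> s < \<epsilon> \<longrightarrow> lin_indep E (\<lambda>e. edge_row d V p e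
        + (\<Sum>l<d. fun_scale (s ^ Suc l) (edge_row d V (\<lambda>w i. if w = v \<and> i = l then 1 else 0) e)))"
    proof (rule lin_indep_perturb[OF fE p(2)])
      fix s :: real and l :: nat assume "0 < s" "s \<le> 1"
      then show "\<bar>s ^ Suc l\<bar> \<le> s" using power_le_one[of s l] by (simp add: mult_left_le)
    qed simp
    then obtain \<epsilon> where \<epsilon>: "\<epsilon> > 0" "\<And>s. 0 < s \<Longrightarrow> s < \<epsilon> \<Longrightarrow> lin_indep E (edge_row d V (?p s))"
      unfolding edge_row_translate by blast
    define bad where "bad W = {s. \<exists>c. (\<Sum>u\<in>W. c u) = 1 \<and>
        (\<forall>i<d. (\<Sum>u\<in>W. c u * p u i) = p v i + s ^ Suc i)}" for W
    have "finite (bad W)" if "W \<subseteq> U" "W \<noteq> {}" "card W \<le> d" for W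
      unfolding bad_def
      by (rule finite_affine_hull_moment_curve[OF finite_subset[OF that(1) insert.hyps(1)] that(2,3)])
    then have "finite (\<Union>W\<in>{W. W \<subseteq> U \<and> W \<noteq> {} \<and> card W \<le> d}. bad W)"
      using insert.hyps(1) by (intro finite_UN_I) auto
    then have "infinite ({0<..<\<epsilon>} - (\<Union>W\<in>{W. W \<subseteq> U \<and> W \<noteq> {} \<and> card W \<le> d}. bad W))"
      using \<epsilon>(1) by (intro Diff_infinite_finite) auto
    then obtain s where "s \<in> {0<..<\<epsilon>} - (\<Union>W\<in>{W. W \<subseteq> U \<and> W \<noteq> {} \<and> card W \<le> d}. bad W)"
      using infinite_imp_nonempty by blast
    then have s: "0 < s" "s < \<epsilon>" "W \<subseteq> U \<Longrightarrow> W \<noteq> {} \<Longrightarrow> card W \<le> d \<Longrightarrow> s \<notin> bad W" for W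
      by auto
    have "general_position d (?p s) (insert v U)" unfolding general_position_def
    proof (intro allI impI)
      fix W c
      assume W: "W \<subseteq> insert v U" "card W \<le> d + 1" and c: "(\<Sum>u\<in>W. c u) = 0"
          "\<forall>i<d. (\<Sum>u\<in>W. c u * ?p s u i) = 0"
      define W' where "W' = W - {v}"
      have fW: "finite W" using W(1) insert.hyps finite_subset by blast
      then have fW': "finite W'" and W'U: "W' \<subseteq> U" using W by (auto simp: W'_def)
      have eq: "(\<Sum>u\<in>W'. c u * ?p s u i) = (\<Sum>u\<in>W'. c u * p u i)" for i
        by (intro sum.cong) (auto simp: W'_def)
      have zero: "\<forall>u\<in>W'. c u = 0" if "(\<Sum>u\<in>W'. c u) = 0" "\<forall>i<d. (\<Sum>u\<in>W'. c u * ?p s u i) = 0"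
      proof
        fix u assume "u \<in> W'"
        have "card W' \<le> d + 1" using W(2) fW card_mono[of W W'] by (auto simp: W'_def)
        then show "c u = 0"
          using general_positionD[OF p(1) W'U _ that(1) _ \<open>u \<in> W'\<close>] that(2) eq by simp
      qed
      show "\<forall>u\<in>W. c u = 0"
      proof (cases "v \<in> W")
        case False
        then have "W = W'" by (simp add: W'_def)
        then show ?thesis using zero c by simp
      next
        case True
        then have WW: "W = insert v W'" "v \<notin> W'" by (auto simp: W'_def)
        have c1: "c v + (\<Sum>u\<in>W'. c u) = 0" using c(1) WW fW' by simp
        have c2: "c v * (p v i + s ^ Suc i) + (\<Sum>u\<in>W'. c u * p u i) = 0" if "i < d" for i
        proof -
          have "0 = (\<Sum>u\<in>insert v W'. c u * ?p s u i)"
            using c(2)[rule_format, OF that] unfolding WW(1) by (rule sym)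
          also have "\<dots> = c v * ?p s v i + (\<Sum>u\<in>W'. c u * ?p s u i)"
            by (rule sum.insert[OF fW' WW(2)])
          also have "\<dots> = c v * (p v i + s ^ Suc i) + (\<Sum>u\<in>W'. c u * p u i)"
            unfolding eq by simp
          finally show ?thesis by (rule sym)
        qed
        show ?thesis
        proof (cases "c v = 0")
          case True
          then have "\<forall>u\<in>W'. c u = 0" using zero c1 c2 eq by simp
          then show ?thesis using True WW by simp
        next
          case False
          then have "W' \<noteq> {}" using c1 by auto
          moreover have "card W' \<le> d" using W(2) WW fW' by simp
          \<comment> \<open>Solving the dependency for \<open>v\<close> writes its new position as
            an affine combination of \<open>W'\<close>.\<close>
          moreover have "s \<in> bad W'" unfolding bad_def mem_Collect_eq
          proof (intro exI[of _ "\<lambda>u. - c u / c v"] conjI allI impI)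
            show "(\<Sum>u\<in>W'. - c u / c v) = 1"
              using c1 False by (simp add: sum_divide_distrib[symmetric] sum_negf field_simps)
            fix i assume "i < d"
            have "(\<Sum>u\<in>W'. - c u / c v * p u i) = - (\<Sum>u\<in>W'. c u * p u i) / c v"
              by (simp add: sum_divide_distrib sum_negf)
            also have "\<dots> = c v * (p v i + s ^ Suc i) / c v"
              using c2[OF \<open>i < d\<close>] by (intro arg_cong[of _ _ "\<lambda>x. x / c v"]) linarith
            also have "\<dots> = p v i + s ^ Suc i" using False by simp
            finally show "(\<Sum>u\<in>W'. - c u / c v * p u i) = p v i + s ^ Suc i" .
          qed
          ultimately show ?thesis using s(3) W'U by blast
        qed
      qed
    qed
    then show ?case using \<epsilon>(2)[OF s(1,2)] by blast
  qed
  then show ?thesis using fV by blast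
qed

text \<open>In a dependency of the rows, look at a vertex of small degree in the support.\<close>

lemma lin_indep_degenerate:
  assumes fV: "finite V" and gp: "general_position d p V" and graph: "simple_graph V L"
    and deg: "\<And>U. U \<subseteq> \<Union>L \<Longrightarrow> U \<noteq> {} \<Longrightarrow> \<exists>v\<in>U. card {e \<in> L. e \<subseteq> U \<and> v \<in> e} \<le> d"
  shows "lin_indep L (edge_row d V p)"
  unfolding lin_indep_def
proof (intro allI impI, rule ccontr)
  fix c assume c: "(\<Sum>e\<in>L. fun_scale (c e) (edge_row d V p e)) = 0" and "\<not> (\<forall>e\<in>L. c e = 0)"
  have L: "e \<subseteq> V" "card e = 2" if "e \<in> L" for e using graph that by (auto simp: simple_graph_def)
  have fL: "finite L" by (rule finite_subset[of _ "Pow V"]) (use L fV in auto)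
  define S where "S = {e \<in> L. c e \<noteq> 0}"
  define U where "U = \<Union>S"
  have "U \<subseteq> \<Union>L" by (auto simp: U_def S_def)
  moreover have "U \<noteq> {}"
  proof -
    obtain e where "e \<in> L" "c e \<noteq> 0" using \<open>\<not> _\<close> by blast
    moreover then have "e \<noteq> {}" using L by fastforce
    ultimately show ?thesis by (auto simp: U_def S_def)
  qed
  ultimately obtain v where v: "v \<in> U" "card {e \<in> L. e \<subseteq> U \<and> v \<in> e} \<le> d" using deg by blast
  define Q where "Q = {e \<in> S. v \<in> e}"
  define w where "w = (\<lambda>e. the_elem (e - {v}))"
  have fQ: "finite Q" using fL by (simp add: Q_def S_def)
  have "Q \<subseteq> {e \<in> L. e \<subseteq> U \<and> v \<in> e}" by (auto simp: Q_def U_def S_def)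
  then have "card Q \<le> card {e \<in> L. e \<subseteq> U \<and> v \<in> e}" using fL by (intro card_mono) auto
  then have cQ: "card Q \<le> d" using v(2) by linarith
  have w: "e = {v, w e}" "w e \<noteq> v" if "e \<in> Q" for e
  proof -
    have "card e = 2" "v \<in> e" using that L by (auto simp: Q_def S_def)
    then obtain u where "e = {v, u}" "u \<noteq> v" by (auto simp: card_2_iff doubleton_eq_iff)
    then show "e = {v, w e}" "w e \<noteq> v" by (auto simp: w_def insert_Diff_if)
  qed
  have inj: "inj_on w Q" using w(1) by (metis inj_onI)
  have "v \<in> V" using v(1) L by (auto simp: U_def S_def)
  have "(\<Sum>e\<in>Q. c e * (p v i - p (w e) i)) = 0" if "i < d" for i
  proof -
    have "0 = (\<Sum>e\<in>L. c e * edge_row d V p e (v, i))"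
      using fun_cong[OF c, of "(v, i)"] by (simp add: sum_fun_apply)
    also have "\<dots> = (\<Sum>e\<in>Q. c e * edge_row d V p e (v, i))"
      by (rule sum.mono_neutral_right[OF fL])
        (auto simp: Q_def S_def matrix_row_def rigidity_matrix_def)
    also have "\<dots> = (\<Sum>e\<in>Q. c e * (p v i - p (w e) i))"
      using \<open>v \<in> V\<close> that
      by (intro sum.cong refl) (auto simp: Q_def matrix_row_def rigidity_matrix_def w_def)
    finally show ?thesis by simp
  qed
  then have stress: "(\<Sum>e\<in>Q. c e) * p v i - (\<Sum>e\<in>Q. c e * p (w e) i) = 0" if "i < d" for i
    using that by (simp add: right_diff_distrib sum_subtractf sum_distrib_right)
  \<comment> \<open>The equilibrium at \<open>v\<close> becomes an affine dependency of
    \<open>v\<close> and its at most d neighbours along \<open>Q\<close>, that is, of at most d + 1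
    points.\<close>
  define b where "b u = (if u = v then (\<Sum>e\<in>Q. c e) else - c {v, u})" for u
  have bw: "b (w e) = - c e" if "e \<in> Q" for e using w[OF that] by (simp add: b_def)
  have nv: "v \<notin> w ` Q" using w(2) by auto
  have split: "(\<Sum>u\<in>insert v (w ` Q). b u * g u) = (\<Sum>e\<in>Q. c e) * g v - (\<Sum>e\<in>Q. c e * g (w e))" for g
    using fQ nv inj by (simp add: sum.reindex bw sum_negf b_def[of v])
  obtain e where e: "e \<in> Q" using v(1) by (auto simp: Q_def U_def)
  have "b (w e) = 0"
  proof (rule general_positionD[OF gp])
    show "insert v (w ` Q) \<subseteq> V" using \<open>v \<in> V\<close> w(1) L by (fastforce simp: Q_def S_def)
    show "card (insert v (w ` Q)) \<le> d + 1"
      using card_image_le[OF fQ, of w] cQ nv fQ by simp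
    show "(\<Sum>u\<in>insert v (w ` Q). b u) = 0" using split[of "\<lambda>_. 1"] by simp
    show "(\<Sum>u\<in>insert v (w ` Q). b u * p u i) = 0" if "i < d" for i
      using split[of "\<lambda>u. p u i"] stress[OF that] by simp
    show "w e \<in> insert v (w ` Q)" using e by simp
  qed
  then show False using bw[OF e] e by (auto simp: Q_def S_def)
qed

section \<open>Stresses and spanning sets of complete graphs\<close>

definition bar_row :: "nat \<Rightarrow> 'a set \<Rightarrow> ('a \<Rightarrow> nat \<Rightarrow> real) \<Rightarrow> 'a \<Rightarrow> 'a \<Rightarrow> 'a \<times> nat \<Rightarrow> real" where
  "bar_row d V p x y = (\<lambda>(w, i). if w \<in> V \<and> i < d then
     (if w = x then p x i - p y i else 0) + (if w = y then p y i - p x i else 0) else 0)"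

lemma edge_row_eq_bar_row: "x \<noteq> y \<Longrightarrow> edge_row d V p {x, y} = bar_row d V p x y"
  by (auto simp: fun_eq_iff matrix_row_def bar_row_def rigidity_matrix_edge)

lemma bar_row_commute: "bar_row d V p x y = bar_row d V p y x"
  by (auto simp: fun_eq_iff bar_row_def)

lemma bar_row_self: "bar_row d V p x x = 0"
  by (auto simp: fun_eq_iff bar_row_def)

text \<open>Summing over y first, the force at x is \<alpha> x times a combination of the two
  vanishing sums. Ordered pairs are allowed because \<open>bar_row\<close> is symmetric and zero on
  the diagonal.\<close>

lemma affine_dependency_stress:
  assumes "finite Z" "(\<Sum>z\<in>Z. \<alpha> z) = 0" "\<And>i. i < d \<Longrightarrow> (\<Sum>z\<in>Z. \<alpha> z * p z i) = 0"
  shows "(\<Sum>x\<in>Z. \<Sum>y\<in>Z. fun_scale (\<alpha> x * \<alpha> y) (bar_row d V p x y)) = 0"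
proof
  fix t :: "'a \<times> nat"
  obtain w i where t: "t = (w, i)" by fastforce
  let ?A = "\<lambda>x y. if w = x then \<alpha> x * \<alpha> y * (p x i - p y i) else 0"
  show "(\<Sum>x\<in>Z. \<Sum>y\<in>Z. fun_scale (\<alpha> x * \<alpha> y) (bar_row d V p x y)) t = 0 t"
  proof (cases "w \<in> V \<and> i < d")
    case True
    have *: "(\<Sum>y\<in>Z. \<alpha> x * \<alpha> y * (p x i - p y i)) = 0" for x
    proof -
      have "(\<Sum>y\<in>Z. \<alpha> x * \<alpha> y * (p x i - p y i))
          = (\<Sum>y\<in>Z. \<alpha> x * p x i * \<alpha> y - \<alpha> x * (\<alpha> y * p y i))"
        by (intro sum.cong refl) (simp add: algebra_simps)
      also have "\<dots> = \<alpha> x * p x i * (\<Sum>y\<in>Z. \<alpha> y) - \<alpha> x * (\<Sum>y\<in>Z. \<alpha> y * p y i)"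
        by (simp only: sum_subtractf sum_distrib_left)
      finally show ?thesis using assms True by simp
    qed
    have A: "(\<Sum>x\<in>Z. \<Sum>y\<in>Z. ?A x y) = 0"
    proof (rule sum.neutral, rule ballI)
      show "(\<Sum>y\<in>Z. ?A x y) = 0" for x using *[of x] by (cases "w = x") simp_all
    qed
    have "(\<Sum>x\<in>Z. \<Sum>y\<in>Z. fun_scale (\<alpha> x * \<alpha> y) (bar_row d V p x y)) t
        = (\<Sum>x\<in>Z. \<Sum>y\<in>Z. ?A x y + ?A y x)"
      using True by (auto simp: t sum_fun_apply bar_row_def intro!: sum.cong)
    also have "\<dots> = (\<Sum>x\<in>Z. \<Sum>y\<in>Z. ?A x y) + (\<Sum>x\<in>Z. \<Sum>y\<in>Z. ?A y x)"
      by (simp only: sum.distrib)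
    also have "(\<Sum>x\<in>Z. \<Sum>y\<in>Z. ?A y x) = (\<Sum>x\<in>Z. \<Sum>y\<in>Z. ?A x y)" by (rule sum.swap)
    finally show ?thesis using A by simp
  qed (auto simp: t sum_fun_apply bar_row_def)
qed

lemma choose_2_real: "real (n choose 2) = real n * (real n - 1) / 2"
  by (induction n) (auto simp: numeral_2_eq_2 field_simps)

text \<open>The edges meeting a fixed set of d vertices span: two further vertices complete it to d + 2
  points, whose affine dependency has no zero coefficient and gives a stress on all their pairs.\<close>

lemma complete_graph_spanned:
  assumes fV: "finite V" and gp: "general_position d p V" and X: "X \<subseteq> V" "d \<le> card X"
  shows "\<exists>B. finite B \<and> real (card B) \<le> real d * card X - real ((d + 1) choose 2) \<and>
    (\<forall>e. e \<subseteq> X \<and> card e = 2 \<longrightarrow> edge_row d V p e \<in> fun_space.span B)"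
proof -
  have fX: "finite X" using X fV finite_subset by blast
  obtain W where W: "W \<subseteq> X" "card W = d" "finite W" using obtain_subset_with_card_n[OF X(2)] by blast
  let ?K = "\<lambda>Y. {e. e \<subseteq> Y \<and> card e = 2}"
  have fK: "finite (?K Y)" if "finite Y" for Y :: "'a set"
    using that by (intro finite_subset[of "?K Y" "Pow Y"]) auto
  \<comment> \<open>Rows of the pairs that meet \<open>W\<close>: with n = \<open>card X\<close>,
    there are (n choose 2) - ((n - d) choose 2) = d n - ((d + 1) choose 2) such pairs.\<close>
  define B where "B = edge_row d V p ` (?K X - ?K (X - W))"
  have fB: "finite B" using fK[OF fX] by (simp add: B_def)
  have "card B \<le> card (?K X - ?K (X - W))" unfolding B_def using fK[OF fX] by (intro card_image_le) simp
  also have "\<dots> = card (?K X) - card (?K (X - W))" using fK fX by (intro card_Diff_subset) auto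
  also have "\<dots> = (card X choose 2) - ((card X - d) choose 2)"
    using n_subsets[OF fX, of 2] n_subsets[of "X - W" 2] fX W by (simp add: card_Diff_subset)
  finally have "card B \<le> (card X choose 2) - ((card X - d) choose 2)" .
  moreover have "(card X - d) choose 2 \<le> card X choose 2" by (intro binomial_right_mono) simp
  ultimately have "real (card B) \<le> real (card X choose 2) - real ((card X - d) choose 2)"
    by linarith
  also have "\<dots> = real d * card X - real ((d + 1) choose 2)"
    using X(2) by (simp add: choose_2_real of_nat_diff field_simps)
  finally have cB: "real (card B) \<le> real d * card X - real ((d + 1) choose 2)" .
  have "edge_row d V p e \<in> fun_space.span B" if e: "e \<subseteq> X" "card e = 2" for e
  proof (cases "e \<subseteq> X - W")
    case False
    then have "edge_row d V p e \<in> B" using e by (auto simp: B_def)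
    then show ?thesis by (rule fun_space.span_base)
  next
    case True
    obtain u v where uv: "e = {u, v}" "u \<noteq> v" using e(2) by (auto simp: card_2_iff)
    have uvW: "u \<in> X" "v \<in> X" "u \<notin> W" "v \<notin> W" using True uv by auto
    define Z where "Z = insert u (insert v W)"
    have Z: "finite Z" "card Z = d + 2" "u \<in> Z" "v \<in> Z" "Z \<subseteq> V"
      using W uv uvW X by (auto simp: Z_def)
    \<comment> \<open>The d coordinates and, at index \<open>d\<close>, the sum of the coefficients:
      d + 1 equations in d + 2 unknowns.\<close>
    obtain \<alpha> :: "'a \<Rightarrow> real" where \<alpha>: "\<exists>z\<in>Z. \<alpha> z \<noteq> 0"
        "\<forall>i\<in>{..d}. (\<Sum>z\<in>Z. (if i < d then p z i else 1) * \<alpha> z) = 0"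
      using homogeneous_system_solvable[of "{..d}" Z "\<lambda>i z. if i < d then p z i else 1"] Z by auto
    have s: "(\<Sum>z\<in>Z. \<alpha> z) = 0" using \<alpha>(2)[rule_format, of d] by simp
    have sp: "(\<Sum>z\<in>Z. \<alpha> z * p z i) = 0" if "i < d" for i
      using \<alpha>(2)[rule_format, of i] that by (simp add: mult.commute)
    have nz: "\<alpha> z \<noteq> 0" if z: "z \<in> Z" for z
    proof
      assume a: "\<alpha> z = 0"
      have "\<alpha> y = 0" if "y \<in> Z - {z}" for y
      proof (rule general_positionD[OF gp _ _ _ _ that])
        show "Z - {z} \<subseteq> V" using Z by auto
        show "card (Z - {z}) \<le> d + 1" using Z z by simp
        show "(\<Sum>u\<in>Z - {z}. \<alpha> u) = 0" using s sum.remove[OF Z(1) z, of \<alpha>] a by simp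
        show "(\<Sum>u\<in>Z - {z}. \<alpha> u * p u i) = 0" if "i < d" for i
          using sp[OF that] sum.remove[OF Z(1) z, of "\<lambda>u. \<alpha> u * p u i"] a by simp
      qed
      then show False using \<alpha>(1) a by blast
    qed
    define g where "g = (\<lambda>(x, y). fun_scale (\<alpha> x * \<alpha> y) (bar_row d V p x y))"
    \<comment> \<open>Both orders of the pair \<open>u\<close>, \<open>v\<close> are split off; any
      other two distinct points of \<open>Z\<close> form a pair meeting \<open>W\<close>, with row
      in \<open>B\<close>.\<close>
    define P where "P = Z \<times> Z - {(u, v), (v, u)}"
    have "0 = (\<Sum>t\<in>Z \<times> Z. g t)"
      using affine_dependency_stress[of Z \<alpha> d p V, OF Z(1) s sp]
      by (simp add: sum.cartesian_product g_def)
    also have "\<dots> = (\<Sum>t\<in>P. g t) + (\<Sum>t\<in>{(u, v), (v, u)}. g t)"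
      unfolding P_def using Z by (intro sum.subset_diff) auto
    also have "(\<Sum>t\<in>{(u, v), (v, u)}. g t) = g (u, v) + g (v, u)" using uv by simp
    also have "g (v, u) = g (u, v)" by (simp add: g_def bar_row_commute[of _ _ _ v] mult.commute)
    finally have eq: "0 = (\<Sum>t\<in>P. g t) + (g (u, v) + g (u, v))" .
    have "bar_row d V p u v = fun_scale (- 1 / (2 * \<alpha> u * \<alpha> v)) (\<Sum>t\<in>P. g t)"
    proof
      fix x
      have "(\<Sum>t\<in>P. g t) x + 2 * (\<alpha> u * \<alpha> v * bar_row d V p u v x) = 0"
        using fun_cong[OF eq, of x] by (simp add: g_def)
      then show "bar_row d V p u v x = - 1 / (2 * \<alpha> u * \<alpha> v) * (\<Sum>t\<in>P. g t) x"
        using nz Z by (simp add: field_simps)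
    qed
    moreover have "(\<Sum>t\<in>P. g t) \<in> fun_space.span B"
    proof (rule fun_space.span_sum)
      fix t assume "t \<in> P"
      then obtain x y where t: "t = (x, y)" "x \<in> Z" "y \<in> Z" "(x, y) \<noteq> (u, v)" "(x, y) \<noteq> (v, u)"
        by (auto simp: P_def)
      have "bar_row d V p x y \<in> fun_space.span B"
      proof (cases "x = y")
        case True
        then show ?thesis by (simp add: bar_row_self fun_space.span_zero)
      next
        case False
        have "{x, y} \<in> ?K X - ?K (X - W)" using False t W uvW by (auto simp: Z_def)
        then have "edge_row d V p {x, y} \<in> B" unfolding B_def by (rule imageI)
        then show ?thesis using edge_row_eq_bar_row[OF False] fun_space.span_base by metis
      qed
      then show "g t \<in> fun_space.span B" by (simp add: t g_def fun_space.span_scale)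
    qed
    ultimately show ?thesis
      using edge_row_eq_bar_row[OF uv(2), of V d p] uv(1) fun_space.span_scale by metis
  qed
  then show ?thesis using fB cB by blast
qed

section \<open>Families of critical sets\<close>

text \<open>\<open>S\<close> is a set so that vertices, as singletons, and edges share one notion
  and compare by inclusion.\<close>

definition multiplicity_in :: "'a set set \<Rightarrow> 'a set \<Rightarrow> nat" where
  "multiplicity_in \<X> S = card {Y \<in> \<X>. S \<subseteq> Y}"

text \<open>Double counting: every element of the union splits a unit weight equally among the sets
  containing it.\<close>

lemma sum_inverse_multiplicity:
  fixes S :: "'i \<Rightarrow> 'b set"
  assumes "finite I" and "\<And>i. i \<in> I \<Longrightarrow> finite (S i)"
  shows "(\<Sum>i\<in>I. \<Sum>a\<in>S i. 1 / real (card {j \<in> I. a \<in> S j})) = real (card (\<Union>i\<in>I. S i))"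
proof -
  let ?U = "\<Union>i\<in>I. S i"
  have "(\<Sum>i\<in>I. \<Sum>a\<in>S i. 1 / real (card {j \<in> I. a \<in> S j}))
      = (\<Sum>i\<in>I. \<Sum>a\<in>{a \<in> ?U. a \<in> S i}. 1 / real (card {j \<in> I. a \<in> S j}))"
    by (intro sum.cong refl) auto
  also have "\<dots> = (\<Sum>a\<in>?U. \<Sum>i\<in>{i \<in> I. a \<in> S i}. 1 / real (card {j \<in> I. a \<in> S j}))"
    using assms by (intro sum.swap_restrict) auto
  also have "\<dots> = (\<Sum>a\<in>?U. 1)"
  proof (rule sum.cong[OF refl])
    fix a assume "a \<in> ?U"
    then have "{i \<in> I. a \<in> S i} \<noteq> {}" by auto
    then have "card {i \<in> I. a \<in> S i} \<noteq> 0" using assms(1) by auto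
    then show "(\<Sum>i\<in>{i \<in> I. a \<in> S i}. 1 / real (card {j \<in> I. a \<in> S j})) = 1"
      by simp
  qed
  finally show ?thesis by simp
qed

lemma inverse_ge_tangent:
  fixes x y :: real
  assumes "x > 0" "y > 0"
  shows "1 / x \<ge> 2 / y - x / y\<^sup>2"
proof -
  have "1 / x - (2 / y - x / y\<^sup>2) = (x - y)\<^sup>2 / (x * y\<^sup>2)"
    using assms by (simp add: field_simps power2_eq_square)
  moreover have "\<dots> \<ge> 0" using assms by simp
  ultimately show ?thesis by linarith
qed

text \<open>Harmonic mean inequality, obtained by adding the tangents of 1 / x at
  \<open>t / card A\<close>, an upper bound for the average of \<open>f\<close>.\<close>

lemma sum_inverse_ge:
  fixes f :: "'b \<Rightarrow> nat"
  assumes fin: "finite A" and pos: "\<And>a. a \<in> A \<Longrightarrow> 1 \<le> f a" and ne: "A \<noteq> {}"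
    and le: "real (\<Sum>a\<in>A. f a) \<le> t"
  shows "(\<Sum>a\<in>A. 1 / real (f a)) \<ge> (real (card A))\<^sup>2 / t"
proof -
  let ?n = "real (card A)"
  have n: "?n > 0" using fin ne by (simp add: card_gt_0_iff)
  have "(\<Sum>a\<in>A. f a) \<ge> (\<Sum>a\<in>A. 1)" using pos by (intro sum_mono) auto
  then have "real (card A) \<le> real (\<Sum>a\<in>A. f a)" by (simp del: of_nat_sum)
  then have t: "t > 0" using le n by linarith
  define y where "y = t / ?n"
  have y: "y > 0" using t n by (simp add: y_def)
  have "?n\<^sup>2 / t = 2 * ?n / y - t / y\<^sup>2"
    using t n by (simp add: y_def field_simps power2_eq_square)
  also have "\<dots> \<le> 2 * ?n / y - real (\<Sum>a\<in>A. f a) / y\<^sup>2"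
    using le y by (simp add: divide_right_mono)
  also have "\<dots> = (\<Sum>a\<in>A. 2 / y - real (f a) / y\<^sup>2)"
    by (simp add: sum_subtractf sum_divide_distrib)
  also have "\<dots> \<le> (\<Sum>a\<in>A. 1 / real (f a))"
  proof (rule sum_mono)
    fix a assume "a \<in> A"
    then have "real (f a) > 0" using pos[of a] by simp
    then show "2 / y - real (f a) / y\<^sup>2 \<le> 1 / real (f a)"
      using y by (rule inverse_ge_tangent)
  qed
  finally show ?thesis .
qed

text \<open>Maximality of the critical sets is replaced by its consequence \<open>thin\<close>,
  which passes to subfamilies, as the induction on the family requires.\<close>

locale critical_family =
  fixes d :: nat and V :: "'a set" and F \<X> :: "'a set set"
  assumes d_pos: "1 \<le> d" and d_le: "d \<le> 5"
    and finite_V: "finite V" and graph: "simple_graph V F" and sparse: "sparse d V F"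
    and sub: "X \<in> \<X> \<Longrightarrow> X \<subseteq> V" and card_ge: "X \<in> \<X> \<Longrightarrow> d \<le> card X"
    and critical: "X \<in> \<X> \<Longrightarrow>
      int (induced_edge_count F X) = int d * int (card X) - int ((d + 1) choose 2)"
    and thin: "X \<in> \<X> \<Longrightarrow> Y \<in> \<X> \<Longrightarrow> X \<noteq> Y \<Longrightarrow> card (X \<inter> Y) < d"
begin

abbreviation k where "k \<equiv> multiplicity_in \<X>"

definition star :: "'a set \<Rightarrow> 'a \<Rightarrow> 'a set set" where
  "star W v = {e \<in> F. e \<subseteq> W \<and> v \<in> e}"

text \<open>For an edge inside a member, \<open>k\<close> counts that member too, hence the
  threshold 2.\<close>

definition shared_star :: "'a set \<Rightarrow> 'a \<Rightarrow> 'a set set" where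
  "shared_star W v = {e \<in> star W v. 2 \<le> k e}"

text \<open>A vertex or an edge of multiplicity k is weighted by 1 - 1 / k, so that summing the potentials
  of all members counts it k - 1 times, the overcount in the sum of the sizes of the members.
  The excess distributes the difference between the potential of W and d |W| - |F[W]| over the
  vertices of W.\<close>

definition potential :: "'a set \<Rightarrow> real" where
  "potential W = (\<Sum>v\<in>W. d * (1 - 1 / k {v})) - (\<Sum>e\<in>{e\<in>F. e \<subseteq> W}. 1 - 1 / k e)"

definition excess :: "'a set \<Rightarrow> 'a \<Rightarrow> real" where
  "excess W v = (\<Sum>e\<in>star W v. 1 / k e) / 2 - d / k {v}"

lemma card_edge: "e \<in> F \<Longrightarrow> card e = 2" and edge_sub: "e \<in> F \<Longrightarrow> e \<subseteq> V"
  using graph by (auto simp: simple_graph_def)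

lemma finite_F: "finite F"
  by (rule finite_subset[of _ "Pow V"]) (use edge_sub finite_V in auto)

lemma finite_\<X>: "finite \<X>"
  by (rule finite_subset[of _ "Pow V"]) (use sub finite_V in auto)

lemma finite_star: "finite (star W v)" and finite_shared_star: "finite (shared_star W v)"
  using finite_F by (auto simp: star_def shared_star_def)

lemma finite_member: "X \<in> \<X> \<Longrightarrow> finite X"
  using sub finite_V finite_subset by blast

lemma k_ge_1: "X \<in> \<X> \<Longrightarrow> S \<subseteq> X \<Longrightarrow> 1 \<le> k S"
proof -
  assume "X \<in> \<X>" "S \<subseteq> X"
  then have "{Y \<in> \<X>. S \<subseteq> Y} \<noteq> {}" by auto
  then show ?thesis using finite_\<X> by (simp add: multiplicity_in_def Suc_le_eq card_gt_0_iff)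
qed

lemma k_antimono: "S \<subseteq> T \<Longrightarrow> k T \<le> k S"
  unfolding multiplicity_in_def by (rule card_mono) (use finite_\<X> in auto)

lemma k_eq: "X \<in> \<X> \<Longrightarrow> S \<subseteq> X \<Longrightarrow> k S = Suc (card {Y \<in> \<X> - {X}. S \<subseteq> Y})"
proof -
  assume "X \<in> \<X>" "S \<subseteq> X"
  then have "{Y \<in> \<X>. S \<subseteq> Y} = insert X {Y \<in> \<X> - {X}. S \<subseteq> Y}" by auto
  then show ?thesis using finite_\<X> by (simp add: multiplicity_in_def)
qed

lemma star_subset: "star W v \<subseteq> (\<lambda>u. {u, v}) ` (W - {v})"
proof
  fix e assume "e \<in> star W v"
  then have "card e = 2" "e \<subseteq> W" "v \<in> e" using card_edge by (auto simp: star_def)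
  then obtain u where "e = {u, v}" "u \<noteq> v" by (auto simp: card_2_iff)
  then show "e \<in> (\<lambda>u. {u, v}) ` (W - {v})" using \<open>e \<subseteq> W\<close> by auto
qed

lemma card_star_le: "finite W \<Longrightarrow> card (star W v) \<le> card (W - {v})"
  by (rule order_trans[OF card_mono[OF _ star_subset] card_image_le]) auto

lemma card_induced_le: "finite Z \<Longrightarrow> card {e \<in> F. e \<subseteq> Z} \<le> card Z choose 2"
proof -
  assume "finite Z"
  have "card {e \<in> F. e \<subseteq> Z} \<le> card {e. e \<subseteq> Z \<and> card e = 2}"
    by (rule card_mono) (use \<open>finite Z\<close> card_edge in auto)
  then show ?thesis using n_subsets[OF \<open>finite Z\<close>] by simp
qed

section \<open>Upper and lower bounds for the potential\<close>

lemma sparse_real: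
  assumes "W \<subseteq> V" "d \<le> card W"
  shows "real (card {e \<in> F. e \<subseteq> W}) \<le> real d * card W - real ((d + 1) choose 2)"
proof -
  have "int (card {e \<in> F. e \<subseteq> W}) \<le> int d * int (card W) - int ((d + 1) choose 2)"
    using sparse assms by (auto simp: sparse_def induced_edge_count_def)
  then have "real_of_int (int (card {e \<in> F. e \<subseteq> W}))
      \<le> real_of_int (int d * int (card W) - int ((d + 1) choose 2))"
    by (rule of_int_le_iff[THEN iffD2])
  then show ?thesis by simp
qed

lemma critical_real:
  assumes "X \<in> \<X>"
  shows "real (card {e \<in> F. e \<subseteq> X}) = real d * card X - real ((d + 1) choose 2)"
proof -
  have "real_of_int (int (card {e \<in> F. e \<subseteq> X}))
      = real_of_int (int d * int (card X) - int ((d + 1) choose 2))"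
    using critical[OF assms] by (simp add: induced_edge_count_def)
  then show ?thesis by simp
qed

text \<open>The sum equals that of the numbers d |X| - |F[X]|, each exactly (d + 1) choose 2 by
  criticality, minus the same expression for the union with only the covered edges counted, which is
  at least (d + 1) choose 2 by sparsity.\<close>

lemma sum_potential_le:
  assumes "\<X> \<noteq> {}"
  shows "(\<Sum>X\<in>\<X>. potential X) \<le> (real (card \<X>) - 1) * real ((d + 1) choose 2)"
proof -
  let ?b = "real ((d + 1) choose 2)" and ?E = "\<lambda>X. {e \<in> F. e \<subseteq> X}"
  have v: "(\<Sum>X\<in>\<X>. \<Sum>v\<in>X. 1 / k {v}) = real (card (\<Union>\<X>))"
    using sum_inverse_multiplicity[of \<X> "\<lambda>X. X"] finite_\<X> finite_member
    by (simp add: multiplicity_in_def)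
  have "(\<Sum>X\<in>\<X>. \<Sum>e\<in>?E X. 1 / k e)
      = (\<Sum>X\<in>\<X>. \<Sum>e\<in>?E X. 1 / real (card {Y \<in> \<X>. e \<in> ?E Y}))"
    by (intro sum.cong refl) (auto simp: multiplicity_in_def)
  also have "\<dots> = real (card (\<Union>X\<in>\<X>. ?E X))"
    by (rule sum_inverse_multiplicity) (use finite_\<X> finite_F in auto)
  finally have e: "(\<Sum>X\<in>\<X>. \<Sum>e\<in>?E X. 1 / k e) = real (card (\<Union>X\<in>\<X>. ?E X))" .
  obtain X where X: "X \<in> \<X>" using assms by auto
  have UV: "\<Union>\<X> \<subseteq> V" using sub by auto
  then have "card X \<le> card (\<Union>\<X>)" using X finite_V finite_subset by (intro card_mono) blast+
  then have "d \<le> card (\<Union>\<X>)" using card_ge[OF X] by linarith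
  then have "real (card (?E (\<Union>\<X>))) \<le> real d * card (\<Union>\<X>) - ?b" using sparse_real UV by blast
  moreover have "card (\<Union>X\<in>\<X>. ?E X) \<le> card (?E (\<Union>\<X>))"
    using finite_F by (intro card_mono) auto
  ultimately have le: "real (card (\<Union>X\<in>\<X>. ?E X)) \<le> real d * card (\<Union>\<X>) - ?b" by linarith
  have "(\<Sum>X\<in>\<X>. potential X) = (\<Sum>X\<in>\<X>. d * real (card X) - real (card (?E X))
      - d * (\<Sum>v\<in>X. 1 / k {v}) + (\<Sum>e\<in>?E X. 1 / k e))"
    by (intro sum.cong refl)
      (simp add: potential_def sum_subtractf right_diff_distrib sum_distrib_left)
  also have "\<dots> = (\<Sum>X\<in>\<X>. ?b - d * (\<Sum>v\<in>X. 1 / k {v}) + (\<Sum>e\<in>?E X. 1 / k e))"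
    by (intro sum.cong refl) (simp add: critical_real)
  also have "\<dots> = real (card \<X>) * ?b - d * (\<Sum>X\<in>\<X>. \<Sum>v\<in>X. 1 / k {v})
      + (\<Sum>X\<in>\<X>. \<Sum>e\<in>?E X. 1 / k e)"
    by (simp add: sum.distrib sum_subtractf sum_distrib_left)
  also have "\<dots> \<le> real (card \<X>) * ?b - ?b" unfolding v e using le by linarith
  finally show ?thesis by (simp add: left_diff_distrib)
qed

text \<open>Each edge hands half of \<open>1 / k e\<close> to either end. What remains is d |W| -
  |F[W]|, bounded by sparsity.\<close>

lemma potential_ge_excess:
  assumes "W \<subseteq> V" "d \<le> card W"
  shows "potential W \<ge> real ((d + 1) choose 2) + (\<Sum>v\<in>W. excess W v)"
proof -
  let ?E = "{e \<in> F. e \<subseteq> W}"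
  have fW: "finite W" using assms(1) finite_V finite_subset by blast
  have "(\<Sum>v\<in>W. \<Sum>e\<in>star W v. 1 / real (k e)) = (\<Sum>v\<in>W. \<Sum>e\<in>{e \<in> ?E. v \<in> e}. 1 / real (k e))"
    by (intro sum.cong refl) (auto simp: star_def)
  also have "\<dots> = (\<Sum>e\<in>?E. \<Sum>v\<in>{v \<in> W. v \<in> e}. 1 / real (k e))"
    using fW finite_F by (intro sum.swap_restrict) auto
  also have "\<dots> = (\<Sum>e\<in>?E. 2 * (1 / real (k e)))"
  proof (rule sum.cong[OF refl])
    fix e assume e: "e \<in> ?E"
    then have "{v \<in> W. v \<in> e} = e" by auto
    then show "(\<Sum>v\<in>{v \<in> W. v \<in> e}. 1 / real (k e)) = 2 * (1 / real (k e))"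
      using card_edge e by simp
  qed
  also have "\<dots> = 2 * (\<Sum>e\<in>?E. 1 / real (k e))" by (rule sum_distrib_left[symmetric])
  finally have h: "(\<Sum>v\<in>W. (\<Sum>e\<in>star W v. 1 / real (k e)) / 2) = (\<Sum>e\<in>?E. 1 / real (k e))"
    by (simp add: sum_divide_distrib[symmetric])
  have "potential W = d * real (card W) - real (card ?E)
      + ((\<Sum>e\<in>?E. 1 / real (k e)) - (\<Sum>v\<in>W. d / k {v}))"
    by (simp add: potential_def sum_subtractf right_diff_distrib sum_distrib_left)
  also have "\<dots> = d * real (card W) - real (card ?E) + (\<Sum>v\<in>W. excess W v)"
    unfolding h[symmetric] by (simp add: excess_def sum_subtractf)
  finally show ?thesis using sparse_real[OF assms] by linarith
qed

text \<open>Edges of multiplicity 1 have weight zero, and a shared edge at \<open>v\<close> weighs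
  at most \<open>1 - 1 / k {v}\<close>, since every member containing it contains
  \<open>v\<close>.\<close>

lemma potential_remove:
  assumes X: "X \<in> \<X>" and W: "W \<subseteq> X" and v: "v \<in> W"
  shows "potential W \<ge> potential (W - {v}) + (real d - card (shared_star W v)) * (1 - 1 / k {v})"
proof -
  let ?E = "\<lambda>W. {e \<in> F. e \<subseteq> W}"
  have fW: "finite W" using W X finite_member finite_subset by blast
  have "?E W = ?E (W - {v}) \<union> star W v" "?E (W - {v}) \<inter> star W v = {}"
    by (auto simp: star_def)
  then have "(\<Sum>e\<in>?E W. 1 - 1 / real (k e))
      = (\<Sum>e\<in>?E (W - {v}). 1 - 1 / real (k e)) + (\<Sum>e\<in>star W v. 1 - 1 / real (k e))"
    using finite_F finite_star by (simp add: sum.union_disjoint)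
  then have "potential W = potential (W - {v}) + d * (1 - 1 / k {v}) - (\<Sum>e\<in>star W v. 1 - 1 / real (k e))"
    using fW v by (simp add: potential_def sum.remove[of W v])
  moreover have "(\<Sum>e\<in>star W v. 1 - 1 / real (k e)) = (\<Sum>e\<in>shared_star W v. 1 - 1 / real (k e))"
  proof (rule sum.mono_neutral_right[OF finite_star])
    show "shared_star W v \<subseteq> star W v" by (auto simp: shared_star_def)
    show "\<forall>e\<in>star W v - shared_star W v. 1 - 1 / real (k e) = 0"
    proof
      fix e assume e: "e \<in> star W v - shared_star W v"
      then have "e \<subseteq> X" using W by (auto simp: star_def)
      moreover have "\<not> 2 \<le> k e" using e by (auto simp: shared_star_def)
      ultimately have "k e = 1" using k_ge_1[OF X, of e] by linarith
      then show "1 - 1 / real (k e) = 0" by simp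
    qed
  qed
  moreover have "(\<Sum>e\<in>shared_star W v. 1 - 1 / real (k e)) \<le> (\<Sum>e\<in>shared_star W v. 1 - 1 / real (k {v}))"
  proof (rule sum_mono)
    fix e assume e: "e \<in> shared_star W v"
    then have "k e \<le> k {v}" "0 < k e" by (auto simp: shared_star_def star_def intro!: k_antimono)
    then show "1 - 1 / real (k e) \<le> 1 - 1 / real (k {v})"
      by (simp add: frac_le)
  qed
  ultimately show ?thesis by (simp add: left_diff_distrib)
qed

text \<open>The degree is taken in \<open>X\<close>, not in the set left at the removal, so the gain
  is independent of the peeling order. The maximum with 0 covers vertices whose shared degree drops
  to d only during the peeling.\<close>

definition peel_gain :: "'a set \<Rightarrow> 'a \<Rightarrow> real" where
  "peel_gain X v = max 0 ((real d - card (shared_star X v)) * (1 - 1 / k {v}))"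

lemma shared_star_mono: "U \<subseteq> W \<Longrightarrow> card (shared_star U v) \<le> card (shared_star W v)"
  by (rule card_mono[OF finite_shared_star]) (auto simp: shared_star_def star_def)

text \<open>Vertices of shared degree at most d are peeled off until none is left. Shared degrees in
  a larger set are no smaller, so \<open>U\<close> survives.\<close>

lemma exists_core:
  assumes X: "X \<in> \<X>" and "W \<subseteq> X" "U \<subseteq> W" and U: "\<And>v. v \<in> U \<Longrightarrow> d < card (shared_star U v)"
  shows "\<exists>C. U \<subseteq> C \<and> C \<subseteq> W \<and> (\<forall>v\<in>C. d < card (shared_star C v)) \<and>
    potential W \<ge> potential C + (\<Sum>v\<in>W - C. peel_gain X v)"
  using assms(2,3)
proof (induction "card W" arbitrary: W)
  case 0
  have "finite W" using 0 X finite_member finite_subset by blast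
  then have "W = {}" using 0 by simp
  then show ?case using 0(3) by (intro exI[of _ "{}"]) simp
next
  case (Suc n)
  have fW: "finite W" using Suc.prems(1) X finite_member finite_subset by blast
  show ?case
  proof (cases "\<forall>v\<in>W. d < card (shared_star W v)")
    case True
    then show ?thesis using Suc.prems(2) by (intro exI[of _ W]) simp
  next
    case False
    then obtain v where v: "v \<in> W" "card (shared_star W v) \<le> d" by auto
    have "v \<notin> U" using U[of v] shared_star_mono[OF Suc.prems(2), of v] v by force
    moreover have "n = card (W - {v})" using Suc.hyps(2) v fW by simp
    ultimately obtain C where C: "U \<subseteq> C" "C \<subseteq> W - {v}" "\<forall>v\<in>C. d < card (shared_star C v)"
      "potential (W - {v}) \<ge> potential C + (\<Sum>v\<in>W - {v} - C. peel_gain X v)"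
      using Suc.hyps(1)[of "W - {v}"] Suc.prems by blast
    have k: "1 \<le> k {v}" using k_ge_1[OF X] v Suc.prems by auto
    then have k': "0 \<le> 1 - 1 / real (k {v})" by simp
    have "card (shared_star W v) \<le> card (shared_star X v)"
      using Suc.prems by (intro shared_star_mono) auto
    then have "(real d - card (shared_star X v)) * (1 - 1 / k {v})
        \<le> (real d - card (shared_star W v)) * (1 - 1 / k {v})"
      using k' by (intro mult_right_mono) auto
    moreover have "0 \<le> (real d - card (shared_star W v)) * (1 - 1 / k {v})"
      using k' v by (intro mult_nonneg_nonneg) auto
    ultimately have "peel_gain X v \<le> (real d - card (shared_star W v)) * (1 - 1 / k {v})"
      by (simp add: peel_gain_def)
    then have "potential W \<ge> potential (W - {v}) + peel_gain X v"
      using potential_remove[OF X Suc.prems(1) v(1)] by linarith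
    moreover have "W - C = insert v (W - {v} - C)" using v C by auto
    then have "(\<Sum>v\<in>W - C. peel_gain X v) = peel_gain X v + (\<Sum>v\<in>W - {v} - C. peel_gain X v)"
      using fW by simp
    ultimately have "potential W \<ge> potential C + (\<Sum>v\<in>W - C. peel_gain X v)"
      using C(4) by linarith
    moreover have "C \<subseteq> W" using C(2) by blast
    ultimately show ?thesis using C(1,3) by blast
  qed
qed

section \<open>Local contributions of the vertices of a core\<close>

lemma k_vertex_eq: "X \<in> \<X> \<Longrightarrow> v \<in> X \<Longrightarrow> k {v} = Suc (card {Y \<in> \<X> - {X}. v \<in> Y})"
  using k_eq[of X "{v}"] by simp

lemma card_thin_minus:
  assumes "X \<in> \<X>" "Y \<in> \<X>" "X \<noteq> Y" "v \<in> X" "v \<in> Y"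
  shows "card (X \<inter> Y - {v}) \<le> d - 2"
proof -
  have "card (X \<inter> Y - {v}) = card (X \<inter> Y) - 1" using assms by (intro card_Diff_singleton) auto
  then show ?thesis using thin[of X Y] assms by simp
qed

text \<open>Counts pairs of an edge in \<open>D\<close> and a further member containing it: such a
  member contains \<open>v\<close> and shares at most d - 2 other vertices with
  \<open>X\<close>.\<close>

lemma sum_shared_multiplicity:
  assumes X: "X \<in> \<X>" and W: "W \<subseteq> X" and v: "v \<in> X" and D: "D \<subseteq> shared_star W v"
  shows "(\<Sum>e\<in>D. k e - 1) \<le> (d - 2) * (k {v} - 1)"
proof -
  let ?Y = "{Y \<in> \<X> - {X}. v \<in> Y}"
  have fD: "finite D" using D finite_shared_star finite_subset by blast
  have De: "e \<subseteq> X" "v \<in> e" if "e \<in> D" for e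
    using that D W by (auto simp: shared_star_def star_def)
  have "(\<Sum>e\<in>D. k e - 1) = (\<Sum>e\<in>D. \<Sum>Y\<in>{Y \<in> ?Y. e \<subseteq> Y}. 1)"
  proof (rule sum.cong[OF refl])
    fix e assume e: "e \<in> D"
    have "{Y \<in> \<X> - {X}. e \<subseteq> Y} = {Y \<in> ?Y. e \<subseteq> Y}" using De[OF e] by auto
    then show "k e - 1 = (\<Sum>Y\<in>{Y \<in> ?Y. e \<subseteq> Y}. 1)" using k_eq[OF X De(1)[OF e]] by simp
  qed
  also have "\<dots> = (\<Sum>Y\<in>?Y. \<Sum>e\<in>{e \<in> D. e \<subseteq> Y}. 1)"
    using fD finite_\<X> by (intro sum.swap_restrict) auto
  also have "\<dots> \<le> (\<Sum>Y\<in>?Y. d - 2)"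
  proof (rule sum_mono)
    fix Y assume Y: "Y \<in> ?Y"
    have "{e \<in> D. e \<subseteq> Y} \<subseteq> star (X \<inter> Y) v"
      using De D by (auto simp: shared_star_def star_def)
    then have "card {e \<in> D. e \<subseteq> Y} \<le> card (star (X \<inter> Y) v)" by (rule card_mono[OF finite_star])
    also have "\<dots> \<le> card (X \<inter> Y - {v})" using finite_member[OF X] by (intro card_star_le) simp
    also have "\<dots> \<le> d - 2" using Y X v by (intro card_thin_minus) auto
    finally show "(\<Sum>e\<in>{e \<in> D. e \<subseteq> Y}. 1) \<le> d - 2" by simp
  qed
  finally show ?thesis using k_vertex_eq[OF X v] by (simp add: mult.commute)
qed

text \<open>With c further members through \<open>v\<close>, any d + 1 shared edges have total
  multiplicity at most (d - 2) c + d + 1, so convexity bounds the sum of their reciprocals below by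
  (d + 1)^2 / ((d - 2) c + d + 1). Half of this reaches d / (c + 1) for all possible c if d is 3 or
  4, and for c \<ge> 4 if d = 5.\<close>

lemma excess_cases:
  assumes X: "X \<in> \<X>" and W: "W \<subseteq> X" and v: "v \<in> X" and deg: "d < card (shared_star W v)"
  shows "excess W v \<ge> 0 \<or> d = 5 \<and> k {v} = 3 \<and> excess W v \<ge> - 1 / 6"
proof -
  obtain D where D: "D \<subseteq> shared_star W v" "card D = d + 1" "finite D"
    using obtain_subset_with_card_n[of "d + 1" "shared_star W v"] deg by auto
  define c where "c = card {Y \<in> \<X> - {X}. v \<in> Y}"
  have kv: "k {v} = Suc c" using k_vertex_eq[OF X v] by (simp add: c_def)
  have k2: "2 \<le> k e" if "e \<in> D" for e using that D by (auto simp: shared_star_def)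
  have "(\<Sum>e\<in>D. k e) = (\<Sum>e\<in>D. (k e - 1) + 1)"
  proof (rule sum.cong[OF refl])
    fix e assume "e \<in> D"
    then show "k e = (k e - 1) + 1" using k2[of e] by simp
  qed
  also have "\<dots> = (\<Sum>e\<in>D. k e - 1) + (d + 1)" unfolding sum.distrib using D by simp
  also have "\<dots> \<le> (d - 2) * c + (d + 1)"
    using sum_shared_multiplicity[OF X W v D(1)] kv by simp
  finally have up: "(\<Sum>e\<in>D. k e) \<le> (d - 2) * c + (d + 1)" .
  have "(\<Sum>e\<in>D. 2) \<le> (\<Sum>e\<in>D. k e)" using k2 by (rule sum_mono)
  \<comment> \<open>Every shared edge lies in a further member, so c cannot be small; for d \<le> 2
    no such vertex exists.\<close>
  then have low: "d + 1 \<le> (d - 2) * c" using up D by simp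
  define s where "s = (\<Sum>e\<in>D. 1 / real (k e))"
  have "s \<le> (\<Sum>e\<in>star W v. 1 / real (k e))" unfolding s_def
    using D(1) by (intro sum_mono2[OF finite_star]) (auto simp: shared_star_def)
  then have ex: "excess W v \<ge> s / 2 - d / (real c + 1)"
    by (simp add: excess_def kv add.commute)
  have "real (\<Sum>e\<in>D. k e) \<le> real ((d - 2) * c + (d + 1))" using up by (rule of_nat_mono)
  then have hm: "s \<ge> (real d + 1)\<^sup>2 / real ((d - 2) * c + (d + 1))"
    using sum_inverse_ge[of D k "real ((d - 2) * c + (d + 1))"] D k2 unfolding s_def
    by (fastforce simp: add.commute)
  have "d = 1 \<or> d = 2 \<or> d = 3 \<or> d = 4 \<or> d = 5" using d_pos d_le by linarith
  moreover have "d \<noteq> 1" "d \<noteq> 2" using low by auto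
  moreover have ?thesis if d: "d = 3"
  proof -
    have c: "c \<ge> 4" using low d by simp
    have "3 / (real c + 1) \<le> 16 / (real c + 4) / 2" using c by (simp add: field_simps)
    also have "16 / (real c + 4) / 2 \<le> s / 2" using hm d by (intro divide_right_mono) simp_all
    finally have "3 / (real c + 1) \<le> s / 2" .
    moreover have "excess W v \<ge> s / 2 - 3 / (real c + 1)" using ex d by simp
    ultimately have "excess W v \<ge> 0" by linarith
    then show ?thesis ..
  qed
  moreover have ?thesis if d: "d = 4"
  proof -
    have c: "c \<ge> 3" using low d by simp
    have "4 / (real c + 1) \<le> 25 / (2 * real c + 5) / 2" using c by (simp add: field_simps)
    also have "25 / (2 * real c + 5) / 2 \<le> s / 2" using hm d by (intro divide_right_mono) simp_all
    finally have "4 / (real c + 1) \<le> s / 2" .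
    moreover have "excess W v \<ge> s / 2 - 4 / (real c + 1)" using ex d by simp
    ultimately have "excess W v \<ge> 0" by linarith
    then show ?thesis ..
  qed
  moreover have ?thesis if d: "d = 5"
  proof (cases "c \<ge> 4")
    case True
    have "5 / (real c + 1) \<le> 36 / (3 * real c + 6) / 2" using True by (simp add: field_simps)
    also have "36 / (3 * real c + 6) / 2 \<le> s / 2" using hm d by (intro divide_right_mono) simp_all
    finally have "5 / (real c + 1) \<le> s / 2" .
    moreover have "excess W v \<ge> s / 2 - 5 / (real c + 1)" using ex d by simp
    ultimately have "excess W v \<ge> 0" by linarith
    then show ?thesis ..
  next
    case False
    \<comment> \<open>The chord of 1 / x through 2 and 3 lies below 1 / x at all integers \<ge> 2;
      for c = 3 it beats the harmonic mean bound. The excess is at least 3/2 - 5/3 = -1/6 for c = 2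
      and 5/4 - 5/4 = 0 for c = 3.\<close>
    have "(\<Sum>e\<in>D. 5 / 6 - real (k e) / 6) \<le> s" unfolding s_def
    proof (rule sum_mono)
      fix e assume e: "e \<in> D"
      have "(real (k e) - 2) * (real (k e) - 3) \<ge> 0"
        using k2[OF e] by (cases "k e = 2") (auto intro: mult_nonneg_nonneg)
      then show "5 / 6 - real (k e) / 6 \<le> 1 / real (k e)"
        using k2[OF e] by (simp add: field_simps)
    qed
    also have "(\<Sum>e\<in>D. 5 / 6 - real (k e) / 6) = 5 - real (\<Sum>e\<in>D. k e) / 6"
      using D d by (simp add: sum_subtractf sum_divide_distrib)
    finally have s: "s \<ge> 5 - real (\<Sum>e\<in>D. k e) / 6" .
    have "real (\<Sum>e\<in>D. k e) \<le> real (3 * c + 6)" using up d by (intro of_nat_mono) simp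
    then have s: "s \<ge> 4 - real c / 2" using s by simp
    have "c = 2 \<or> c = 3" using low d False by auto
    then show ?thesis using s ex d kv by auto
  qed
  ultimately show ?thesis by blast
qed

text \<open>With y = \<open>card (Y \<inter> Z)\<close>, the union has |X| + |Y| + |Z| - 7 - y
  vertices and spans at least |F[X]| + |F[Y]| + |F[Z]| - 12 - (y choose 2) edges. Sparsity then
  reads 5 y \<le> 7 + (y choose 2), which among 1, 2, 3, 4 holds only for y = 1.\<close>

lemma card_inter_two_fours:
  assumes d: "d = 5" and mem: "X \<in> \<X>" "Y \<in> \<X>" "Z \<in> \<X>" and ne: "X \<noteq> Y" "X \<noteq> Z" "Y \<noteq> Z"
    and card: "card (X \<inter> Y) = 4" "card (X \<inter> Z) = 4" and meet: "X \<inter> Y \<inter> Z = {v}"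
  shows "card (Y \<inter> Z) = 1"
proof -
  let ?E = "\<lambda>W. {e \<in> F. e \<subseteq> W}"
  have fin: "finite X" "finite Y" "finite Z" using mem finite_member by auto
  have fE: "finite (?E W)" for W using finite_F by simp
  have v1: "card (X \<union> Y) + card (X \<inter> Y) = card X + card Y"
    using fin card_Un_Int[of X Y] by simp
  have "(X \<union> Y) \<inter> Z = (X \<inter> Z) \<union> (Y \<inter> Z)" "(X \<inter> Z) \<inter> (Y \<inter> Z) = {v}" using meet by auto
  then have v2: "card ((X \<union> Y) \<inter> Z) + 1 = card (X \<inter> Z) + card (Y \<inter> Z)"
    using fin card_Un_Int[of "X \<inter> Z" "Y \<inter> Z"] by simp
  have v3: "card (X \<union> Y \<union> Z) + card ((X \<union> Y) \<inter> Z) = card (X \<union> Y) + card Z"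
    using fin card_Un_Int[of "X \<union> Y" Z] by simp
  have e1: "card (?E X \<union> ?E Y) + card (?E (X \<inter> Y)) = card (?E X) + card (?E Y)"
  proof -
    have "?E X \<inter> ?E Y = ?E (X \<inter> Y)" by auto
    then show ?thesis using card_Un_Int[OF fE fE, of X Y] by simp
  qed
  have "(?E X \<union> ?E Y) \<inter> ?E Z \<subseteq> ?E (X \<inter> Z) \<union> ?E (Y \<inter> Z)" by auto
  then have "card ((?E X \<union> ?E Y) \<inter> ?E Z) \<le> card (?E (X \<inter> Z) \<union> ?E (Y \<inter> Z))"
    by (intro card_mono finite_UnI fE)
  also have "\<dots> \<le> card (?E (X \<inter> Z)) + card (?E (Y \<inter> Z))" by (rule card_Un_le)
  finally have e2: "card ((?E X \<union> ?E Y) \<inter> ?E Z) \<le> card (?E (X \<inter> Z)) + card (?E (Y \<inter> Z))" .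
  have e3: "card (?E X \<union> ?E Y \<union> ?E Z) + card ((?E X \<union> ?E Y) \<inter> ?E Z) = card (?E X \<union> ?E Y) + card (?E Z)"
    using fE card_Un_Int[of "?E X \<union> ?E Y" "?E Z"] by simp
  have e4: "card (?E X \<union> ?E Y \<union> ?E Z) \<le> card (?E (X \<union> Y \<union> Z))"
    using finite_F by (intro card_mono) auto
  have six: "4 choose 2 = (6::nat)" by (simp add: choose_two)
  have e5: "card (?E (X \<inter> Y)) \<le> 6" "card (?E (X \<inter> Z)) \<le> 6"
      "card (?E (Y \<inter> Z)) \<le> card (Y \<inter> Z) choose 2"
    using card_induced_le[of "X \<inter> Y"] card_induced_le[of "X \<inter> Z"] card_induced_le[of "Y \<inter> Z"] fin card six
    by auto
  have fifteen: "(d + 1) choose 2 = 15" using d by (simp add: choose_two)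
  have "X \<union> Y \<union> Z \<subseteq> V" using sub mem by auto
  moreover have "card X \<le> card (X \<union> Y \<union> Z)" using fin by (intro card_mono) auto
  then have "d \<le> card (X \<union> Y \<union> Z)" using card_ge[OF mem(1)] by linarith
  ultimately have sp: "real (card (?E (X \<union> Y \<union> Z))) \<le> 5 * real (card (X \<union> Y \<union> Z)) - 15"
    using sparse_real[of "X \<union> Y \<union> Z"] d fifteen by simp
  have cr: "real (card (?E W)) = 5 * real (card W) - 15" if "W \<in> \<X>" for W
    using critical_real[OF that] d fifteen by simp
  define y where "y = card (Y \<inter> Z)"
  have "v \<in> Y \<inter> Z" using meet by auto
  then have "y \<noteq> 0" using fin by (auto simp: y_def)
  moreover have "y < 5" using thin[OF mem(2,3) ne(3)] d by (simp add: y_def)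
  ultimately have y: "y = 1 \<or> y = 2 \<or> y = 3 \<or> y = 4" by linarith
  have "5 * real y \<le> 7 + real (y choose 2)"
    using v1 v2 v3 e1 e2 e3 e4 e5 sp cr[OF mem(1)] cr[OF mem(2)] cr[OF mem(3)] card
    unfolding y_def[symmetric] by linarith
  then show ?thesis using y by (auto simp: y_def[symmetric] choose_two)
qed

text \<open>A vertex of negative excess lies in exactly three members, and sparsity of their union
  forces it to have small shared degree in the other two.\<close>

lemma card_shared_star_other:
  assumes d: "d = 5" and X: "X \<in> \<X>" and W: "W \<subseteq> X" and v: "v \<in> X" and kv: "k {v} = 3"
    and deg: "5 < card (shared_star W v)" and Y: "Y \<in> \<X>" "Y \<noteq> X" "v \<in> Y"
  shows "card (shared_star Y v) \<le> 3"
proof -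
  let ?Y = "{Y \<in> \<X> - {X}. v \<in> Y}"
  have "card ?Y = 2" using k_vertex_eq[OF X v] kv by simp
  then have "card (?Y - {Y}) = 1" using Y by simp
  then obtain Z where Z: "?Y - {Y} = {Z}" by (auto simp: card_1_singleton_iff)
  then have mem: "Z \<in> \<X>" "Z \<noteq> X" "v \<in> Z" "Y \<noteq> Z" by blast+
  have YZ: "?Y = {Y, Z}" using Z Y by blast
  have fX: "finite X" using X finite_member by blast
  have sub_star: "shared_star W v \<subseteq> star (X \<inter> Y) v \<union> star (X \<inter> Z) v"
  proof
    fix e assume e: "e \<in> shared_star W v"
    then have eX: "e \<subseteq> X" "v \<in> e" "e \<in> F" "2 \<le> k e" using W by (auto simp: shared_star_def star_def)
    then have "card {Y \<in> \<X> - {X}. e \<subseteq> Y} \<noteq> 0" using k_eq[OF X eX(1)] by simp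
    then obtain T where "T \<in> \<X> - {X}" "e \<subseteq> T" by (metis (no_types, lifting) card.empty empty_Collect_eq)
    then have "T \<in> ?Y" using eX by auto
    then show "e \<in> star (X \<inter> Y) v \<union> star (X \<inter> Z) v"
      using eX \<open>e \<subseteq> T\<close> unfolding YZ by (auto simp: star_def)
  qed
  let ?A = "X \<inter> Y - {v}" and ?B = "X \<inter> Z - {v}"
  have "star (X \<inter> Y) v \<union> star (X \<inter> Z) v \<subseteq> (\<lambda>u. {u, v}) ` (?A \<union> ?B)"
    using star_subset[of "X \<inter> Y" v] star_subset[of "X \<inter> Z" v] by blast
  then have "shared_star W v \<subseteq> (\<lambda>u. {u, v}) ` (?A \<union> ?B)" using sub_star by blast
  then have "card (shared_star W v) \<le> card ((\<lambda>u. {u, v}) ` (?A \<union> ?B))"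
    using fX by (intro card_mono) auto
  also have "\<dots> \<le> card (?A \<union> ?B)" using fX by (intro card_image_le) auto
  \<comment> \<open>At least six neighbours of \<open>v\<close> in two sets of at most three: both
    have exactly three and they are disjoint.\<close>
  finally have "6 \<le> card (?A \<union> ?B)" using deg by linarith
  moreover have "card (?A \<union> ?B) + card (?A \<inter> ?B) = card ?A + card ?B"
    using fX card_Un_Int[of ?A ?B] by simp
  moreover have AB: "card ?A \<le> 3" "card ?B \<le> 3"
    using card_thin_minus[OF X Y(1)] card_thin_minus[OF X mem(1)] d v Y mem by auto
  ultimately have cards: "card ?A = 3" "card ?B = 3" "card (?A \<inter> ?B) = 0" by linarith+
  have "card (X \<inter> Y) = Suc (card ?A)" by (rule card.remove) (use fX v Y in auto)
  moreover have "card (X \<inter> Z) = Suc (card ?B)" by (rule card.remove) (use fX v mem in auto)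
  ultimately have four: "card (X \<inter> Y) = 4" "card (X \<inter> Z) = 4" using cards by auto
  have "?A \<inter> ?B = {}" using cards(3) fX by simp
  then have "X \<inter> Y \<inter> Z = {v}" using v Y(3) mem(3) by blast
  then have "card (Y \<inter> Z) = 1"
    using card_inter_two_fours[OF d X Y(1) mem(1)] Y mem four by blast
  then obtain w where "Y \<inter> Z = {w}" by (rule card_1_singletonE)
  then have inter: "Y \<inter> Z = {v}" using Y(3) mem(3) by (metis Int_iff singletonD)
  \<comment> \<open>No edge fits into \<open>Y \<inter> Z\<close>, so \<open>Y\<close> can share its
    edges at \<open>v\<close> only with \<open>X\<close>.\<close>
  have "shared_star Y v \<subseteq> star (X \<inter> Y) v"
  proof
    fix e assume e: "e \<in> shared_star Y v"
    then have eY: "e \<subseteq> Y" "v \<in> e" "e \<in> F" "2 \<le> k e" by (auto simp: shared_star_def star_def)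
    then have "card {T \<in> \<X> - {Y}. e \<subseteq> T} \<noteq> 0" using k_eq[OF Y(1) eY(1)] by simp
    then obtain T where T: "T \<in> \<X>" "T \<noteq> Y" "e \<subseteq> T"
      by (metis (no_types, lifting) card.empty empty_Collect_eq DiffE insertI1)
    then have "T = X \<or> T \<in> ?Y" using eY by auto
    then have "T = X \<or> T = Z" using T unfolding YZ by auto
    moreover have "T \<noteq> Z"
    proof
      assume "T = Z"
      then have "e \<subseteq> {v}" using inter eY T by auto
      then have "card e \<le> 1" using card_mono[of "{v}" e] by simp
      then show False using card_edge eY by fastforce
    qed
    ultimately show "e \<in> star (X \<inter> Y) v" using eY T by (auto simp: star_def)
  qed
  then have "card (shared_star Y v) \<le> card (star (X \<inter> Y) v)" by (rule card_mono[OF finite_star])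
  also have "\<dots> \<le> card ?A" using fX by (intro card_star_le) simp
  finally show ?thesis using cards by simp
qed

lemma exists_degenerate_member:
  assumes "\<X> \<noteq> {}"
  shows "\<exists>X\<in>\<X>. \<forall>U\<subseteq>X. U \<noteq> {} \<longrightarrow> (\<exists>v\<in>U. card (shared_star U v) \<le> d)"
proof (rule ccontr)
  let ?b = "real ((d + 1) choose 2)"
  assume neg: "\<not> ?thesis"
  have "\<exists>C\<subseteq>X. C \<noteq> {} \<and> (\<forall>v\<in>C. d < card (shared_star C v)) \<and>
      potential X \<ge> potential C + (\<Sum>v\<in>X - C. peel_gain X v)" if X: "X \<in> \<X>" for X
  proof -
    have "\<not> (\<forall>U\<subseteq>X. U \<noteq> {} \<longrightarrow> (\<exists>v\<in>U. card (shared_star U v) \<le> d))" using neg X by blast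
    then obtain U where U: "U \<subseteq> X" "U \<noteq> {}" "\<And>v. v \<in> U \<Longrightarrow> d < card (shared_star U v)"
      using not_le by blast
    obtain C where C: "U \<subseteq> C" "C \<subseteq> X" "\<forall>v\<in>C. d < card (shared_star C v)"
        "potential X \<ge> potential C + (\<Sum>v\<in>X - C. peel_gain X v)"
      using exists_core[OF X subset_refl U(1,3)] by blast
    have "C \<noteq> {}" using C(1) U(2) by blast
    then show ?thesis using C by blast
  qed
  then obtain C where C: "\<And>X. X \<in> \<X> \<Longrightarrow> C X \<subseteq> X" "\<And>X. X \<in> \<X> \<Longrightarrow> C X \<noteq> {}"
      "\<And>X v. X \<in> \<X> \<Longrightarrow> v \<in> C X \<Longrightarrow> d < card (shared_star (C X) v)"
      "\<And>X. X \<in> \<X> \<Longrightarrow> potential X \<ge> potential (C X) + (\<Sum>v\<in>X - C X. peel_gain X v)"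
    by metis
  define \<beta> where "\<beta> X v = (if v \<in> C X then excess (C X) v else peel_gain X v)" for X v
  have pot: "potential X \<ge> ?b + (\<Sum>v\<in>X. \<beta> X v)" if X: "X \<in> \<X>" for X
  proof -
    have fX: "finite X" and fC: "finite (C X)" using X finite_member C(1) finite_subset by blast+
    \<comment> \<open>A core vertex has more than d neighbours in the core, so the core is large
      enough for sparsity to apply.\<close>
    obtain v where v: "v \<in> C X" using C(2)[OF X] by blast
    have "d < card (shared_star (C X) v)" using C(3)[OF X v] .
    also have "\<dots> \<le> card (star (C X) v)"
      by (rule card_mono[OF finite_star]) (auto simp: shared_star_def)
    also have "\<dots> \<le> card (C X - {v})" using fC by (rule card_star_le)
    also have "\<dots> \<le> card (C X)" using fC by (intro card_mono) auto
    finally have "d \<le> card (C X)" by simp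
    moreover have "C X \<subseteq> V" using C(1)[OF X] sub[OF X] by blast
    ultimately have "potential (C X) \<ge> ?b + (\<Sum>v\<in>C X. excess (C X) v)"
      by (intro potential_ge_excess)
    moreover have "(\<Sum>v\<in>X. \<beta> X v) = (\<Sum>v\<in>X - C X. \<beta> X v) + (\<Sum>v\<in>C X. \<beta> X v)"
      using fX C(1)[OF X] by (rule sum.subset_diff[rotated])
    moreover have "(\<Sum>v\<in>C X. \<beta> X v) = (\<Sum>v\<in>C X. excess (C X) v)"
      by (intro sum.cong) (auto simp: \<beta>_def)
    moreover have "(\<Sum>v\<in>X - C X. \<beta> X v) = (\<Sum>v\<in>X - C X. peel_gain X v)"
      by (intro sum.cong) (auto simp: \<beta>_def)
    ultimately show ?thesis using C(4)[OF X] by linarith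
  qed
  have nonneg: "(\<Sum>X\<in>{X \<in> \<X>. v \<in> X}. \<beta> X v) \<ge> 0" for v
  proof (cases "\<forall>X\<in>\<X>. v \<in> X \<longrightarrow> \<beta> X v \<ge> 0")
    case True
    then show ?thesis by (intro sum_nonneg) auto
  next
    case False
    then obtain X where X: "X \<in> \<X>" "v \<in> X" "\<beta> X v < 0" by auto
    have "v \<in> C X" using X(3) by (auto simp: \<beta>_def peel_gain_def split: if_splits)
    then have ex: "\<beta> X v = excess (C X) v" by (simp add: \<beta>_def)
    have deg: "d < card (shared_star (C X) v)" using C(3)[OF X(1) \<open>v \<in> C X\<close>] .
    have *: "d = 5" "k {v} = 3" "\<beta> X v \<ge> - 1 / 6"
      using excess_cases[OF X(1) C(1)[OF X(1)] X(2) deg] X(3) ex by auto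
    let ?R = "{Y \<in> \<X> - {X}. v \<in> Y}"
    have "card ?R = 2" using k_vertex_eq[OF X(1,2)] * by simp
    \<comment> \<open>Shared degree at most 3 keeps \<open>v\<close> out of the core of
      \<open>Y\<close>, and peeling it gains at least (5 - 3) (1 - 1/3) = 4/3. The bound 1 for each
      of two members already outweighs 1/6.\<close>
    have "\<beta> Y v \<ge> 1" if Y: "Y \<in> ?R" for Y
    proof -
      have small: "card (shared_star Y v) \<le> 3"
        using card_shared_star_other[OF *(1) X(1) C(1)[OF X(1)] X(2) *(2)] deg * Y by auto
      then have "v \<notin> C Y"
        using C(3)[of Y v] shared_star_mono[OF C(1), of Y v] Y * by fastforce
      then have "\<beta> Y v = peel_gain Y v" by (simp add: \<beta>_def)
      moreover have gain: "peel_gain Y v \<ge> (real d - card (shared_star Y v)) * (1 - 1 / k {v})"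
        by (simp add: peel_gain_def)
      have "(real d - card (shared_star Y v)) * (1 - 1 / k {v})
          = 10 / 3 - 2 / 3 * real (card (shared_star Y v))"
        using * by (simp add: field_simps)
      note gain[unfolded this]
      moreover have "real (card (shared_star Y v)) \<le> 3" using small by simp
      ultimately show ?thesis by linarith
    qed
    then have "(\<Sum>Y\<in>?R. \<beta> Y v) \<ge> of_nat (card ?R) * 1" by (rule sum_bounded_below)
    moreover have "{X \<in> \<X>. v \<in> X} = insert X ?R" using X by auto
    then have "(\<Sum>X\<in>{X \<in> \<X>. v \<in> X}. \<beta> X v) = \<beta> X v + (\<Sum>Y\<in>?R. \<beta> Y v)"
      using finite_\<X> by simp
    ultimately show ?thesis using *(3) \<open>card ?R = 2\<close> by simp
  qed
  have "(\<Sum>X\<in>\<X>. \<Sum>v\<in>X. \<beta> X v) = (\<Sum>X\<in>\<X>. \<Sum>v\<in>{v \<in> V. v \<in> X}. \<beta> X v)"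
    using sub by (intro sum.cong refl) auto
  also have "\<dots> = (\<Sum>v\<in>V. \<Sum>X\<in>{X \<in> \<X>. v \<in> X}. \<beta> X v)"
    using finite_\<X> finite_V by (intro sum.swap_restrict)
  also have "\<dots> \<ge> 0" by (rule sum_nonneg) (rule nonneg)
  finally have "(\<Sum>X\<in>\<X>. \<Sum>v\<in>X. \<beta> X v) \<ge> 0" .
  \<comment> \<open>Each core supplies one full \<open>?b\<close>, in total one more than the union
    permits.\<close>
  then have "card \<X> * ?b \<le> (\<Sum>X\<in>\<X>. ?b + (\<Sum>v\<in>X. \<beta> X v))" by (simp add: sum.distrib)
  also have "\<dots> \<le> (\<Sum>X\<in>\<X>. potential X)" using pot by (rule sum_mono)
  also have "\<dots> \<le> (real (card \<X>) - 1) * ?b" using assms by (rule sum_potential_le)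
  finally have "?b \<le> 0" by (simp add: left_diff_distrib)
  moreover have "(d + 1) choose 2 > 0" using d_pos by (simp add: zero_less_binomial_iff)
  ultimately show False by simp
qed

end

section \<open>The rank bound\<close>

lemma critical_family_subset:
  assumes "critical_family d V F \<X>" and "\<Y> \<subseteq> \<X>"
  shows "critical_family d V F \<Y>"
proof -
  interpret critical_family d V F \<X> by fact
  have mem: "X \<in> \<X>" if "X \<in> \<Y>" for X using that assms(2) by (rule subsetD[rotated])
  show ?thesis
    by (rule critical_family.intro[OF d_pos d_le finite_V graph sparse
          sub[OF mem] card_ge[OF mem] critical[OF mem] thin[OF mem mem]])
qed

text \<open>The members are added in an order in which the edges that a new member shares with the
  earlier ones are independent, so that the rank grows by at most the number of its new edges.\<close>

lemma critical_family_spanned: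
  assumes "critical_family d V F \<X>" and gp: "general_position d p V"
  shows "\<exists>T. finite T \<and> card T \<le> card {e \<in> F. \<exists>X\<in>\<X>. e \<subseteq> X} \<and>
    (\<forall>X\<in>\<X>. \<forall>e. e \<subseteq> X \<and> card e = 2 \<longrightarrow> edge_row d V p e \<in> fun_space.span T)"
  using assms(1)
proof (induction "card \<X>" arbitrary: \<X>)
  case 0
  then have "\<X> = {}" using critical_family.finite_\<X> by fastforce
  then show ?case by (intro exI[of _ "{}"]) simp
next
  case (Suc n)
  interpret critical_family d V F \<X> by (rule Suc.prems)
  let ?r = "edge_row d V p"
  have "\<X> \<noteq> {}" using Suc.hyps(2) by auto
  then obtain X where X: "X \<in> \<X>"
      and deg: "\<And>U. U \<subseteq> X \<Longrightarrow> U \<noteq> {} \<Longrightarrow> \<exists>v\<in>U. card (shared_star U v) \<le> d"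
    using exists_degenerate_member by blast
  define \<Y> where "\<Y> = \<X> - {X}"
  have "critical_family d V F \<Y>" "n = card \<Y>"
    using critical_family_subset[OF Suc.prems] Suc.hyps(2) X finite_\<X> by (auto simp: \<Y>_def)
  then obtain T where T: "finite T" "card T \<le> card {e \<in> F. \<exists>Y\<in>\<Y>. e \<subseteq> Y}"
      "\<And>Y e. Y \<in> \<Y> \<Longrightarrow> e \<subseteq> Y \<Longrightarrow> card e = 2 \<Longrightarrow> ?r e \<in> fun_space.span T"
    using Suc.hyps(1)[of \<Y>] by blast
  define L where "L = {e \<in> F. e \<subseteq> X \<and> (\<exists>Y\<in>\<Y>. e \<subseteq> Y)}"
  have fL: "finite L" using finite_F by (simp add: L_def)
  have k2: "2 \<le> k e" if e: "e \<in> L" for e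
  proof -
    have "{Y \<in> \<X> - {X}. e \<subseteq> Y} \<noteq> {}" using e by (auto simp: L_def \<Y>_def)
    then have "0 < card {Y \<in> \<X> - {X}. e \<subseteq> Y}" using finite_\<X> by (simp add: card_gt_0_iff)
    then show ?thesis using k_eq[OF X, of e] e by (simp add: L_def)
  qed
  have "lin_indep L ?r"
  proof (rule lin_indep_degenerate[OF finite_V gp])
    show "simple_graph V L" using graph by (auto simp: simple_graph_def L_def)
    fix U assume U: "U \<subseteq> \<Union>L" "U \<noteq> {}"
    then have "U \<subseteq> X" by (auto simp: L_def)
    then obtain v where v: "v \<in> U" "card (shared_star U v) \<le> d" using deg U(2) by blast
    have "{e \<in> L. e \<subseteq> U \<and> v \<in> e} \<subseteq> shared_star U v"
      using k2 by (auto simp: shared_star_def star_def L_def)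
    then have "card {e \<in> L. e \<subseteq> U \<and> v \<in> e} \<le> card (shared_star U v)"
      by (rule card_mono[OF finite_shared_star])
    then show "\<exists>v\<in>U. card {e \<in> L. e \<subseteq> U \<and> v \<in> e} \<le> d" using v by (intro bexI[of _ v]) auto
  qed
  then have L: "inj_on ?r L" "fun_space.independent (?r ` L)" using lin_indep_iff[OF fL, of ?r] by blast+
  let ?K = "{e. e \<subseteq> X \<and> card e = 2}"
  have "?r ` L \<subseteq> ?r ` ?K" using card_edge by (auto simp: L_def)
  \<comment> \<open>The rows of \<open>L\<close> are already spanned by \<open>T\<close>, so
    completing them to a basis for the complete graph on \<open>X\<close> costs
    \<open>card B - card L\<close> new vectors, at most the number of edges of \<open>F\<close>
    inside \<open>X\<close> but in no earlier member.\<close>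
  then obtain B where B: "?r ` L \<subseteq> B" "B \<subseteq> ?r ` ?K" "fun_space.independent B" "?r ` ?K \<subseteq> fun_space.span B"
    using fun_space.maximal_independent_subset_extend[OF _ L(2)] by blast
  obtain B\<^sub>0 where B0: "finite B\<^sub>0" "real (card B\<^sub>0) \<le> real d * card X - real ((d + 1) choose 2)"
      "\<forall>e. e \<subseteq> X \<and> card e = 2 \<longrightarrow> ?r e \<in> fun_space.span B\<^sub>0"
    using complete_graph_spanned[OF finite_V gp sub[OF X] card_ge[OF X]] by blast
  have "B \<subseteq> fun_space.span B\<^sub>0" using B(2) B0(3) by blast
  then have Bf: "finite B" "card B \<le> card B\<^sub>0"
    using fun_space.independent_span_bound[OF B0(1) B(3)] by auto
  have cB: "card B \<le> card {e \<in> F. e \<subseteq> X}" using Bf(2) B0(2) critical_real[OF X] by simp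
  define T' where "T' = T \<union> (B - ?r ` L)"
  have "card T' \<le> card T + card (B - ?r ` L)" unfolding T'_def by (rule card_Un_le)
  also have "card (B - ?r ` L) = card B - card L"
    using B(1) fL L(1) by (simp add: card_Diff_subset card_image)
  also have "card T + (card B - card L) \<le> card {e \<in> F. \<exists>Y\<in>\<X>. e \<subseteq> Y}"
  proof -
    let ?A = "{e \<in> F. \<exists>Y\<in>\<Y>. e \<subseteq> Y}" and ?C = "{e \<in> F. e \<subseteq> X}"
    have "{e \<in> F. \<exists>Y\<in>\<X>. e \<subseteq> Y} = ?A \<union> ?C" using X by (auto simp: \<Y>_def)
    moreover have "?A \<inter> ?C = L" by (auto simp: L_def)
    moreover have "card ?A + card ?C = card (?A \<union> ?C) + card (?A \<inter> ?C)"
      using finite_F by (intro card_Un_Int) auto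
    moreover have "card L \<le> card B" using card_mono[OF Bf(1) B(1)] L(1) by (simp add: card_image)
    ultimately show ?thesis using T(2) cB by simp
  qed
  finally have "card T' \<le> card {e \<in> F. \<exists>Y\<in>\<X>. e \<subseteq> Y}" .
  moreover have "finite T'" using T(1) Bf(1) by (simp add: T'_def)
  moreover have "?r e \<in> fun_space.span T'" if Y: "Y \<in> \<X>" "e \<subseteq> Y" "card e = 2" for Y e
  proof -
    have TT': "fun_space.span T \<subseteq> fun_space.span T'" by (rule fun_space.span_mono) (simp add: T'_def)
    show ?thesis
    proof (cases "Y = X")
      case False
      then show ?thesis using T(3)[of Y e] Y TT' by (auto simp: \<Y>_def)
    next
      case True
      have "?r f \<in> fun_space.span T" if "f \<in> L" for f
        using that T(3)[of _ f] card_edge[of f] by (auto simp: L_def)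
      then have "?r ` L \<subseteq> fun_space.span T'" using TT' by blast
      moreover have "B - ?r ` L \<subseteq> fun_space.span T'"
        using fun_space.span_superset[of T'] by (simp add: T'_def)
      ultimately have "B \<subseteq> fun_space.span T'" by blast
      then have "fun_space.span B \<subseteq> fun_space.span T'"
        by (rule fun_space.span_minimal) (rule fun_space.subspace_span)
      then show ?thesis using B(4) Y True by blast
    qed
  qed
  ultimately show ?case by blast
qed

section \<open>Uncrossing critical sets\<close>

lemma induced_edge_count_supermodular:
  assumes "finite F"
  shows "induced_edge_count F X + induced_edge_count F Y
    \<le> induced_edge_count F (X \<union> Y) + induced_edge_count F (X \<inter> Y)"
proof -
  let ?E = "\<lambda>X. {e \<in> F. e \<subseteq> X}"
  have "card (?E X) + card (?E Y) = card (?E X \<union> ?E Y) + card (?E X \<inter> ?E Y)"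
    using assms by (intro card_Un_Int) auto
  moreover have "?E X \<inter> ?E Y = ?E (X \<inter> Y)" by auto
  moreover have "card (?E X \<union> ?E Y) \<le> card (?E (X \<union> Y))" using assms by (intro card_mono) auto
  ultimately show ?thesis by (simp add: induced_edge_count_def)
qed

definition critical_sets :: "nat \<Rightarrow> 'a set \<Rightarrow> 'a set set \<Rightarrow> 'a set set" where
  "critical_sets d V F = {X. X \<subseteq> V \<and> d \<le> card X \<and>
     int (induced_edge_count F X) = int d * int (card X) - int ((d + 1) choose 2)}"

text \<open>Supermodularity of the edge count forces equality in the sparsity bounds of union and
  intersection; \<open>le\<close> makes the bound available for the intersection.\<close>

lemma critical_sets_Un:
  assumes fV: "finite V" and fF: "finite F" and sp: "sparse d V F"
    and X: "X \<in> critical_sets d V F" and Y: "Y \<in> critical_sets d V F" and le: "d \<le> card (X \<inter> Y)"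
  shows "X \<union> Y \<in> critical_sets d V F"
proof -
  have V: "X \<union> Y \<subseteq> V" "X \<inter> Y \<subseteq> V" using X Y by (auto simp: critical_sets_def)
  have fin: "finite X" "finite Y" using V fV finite_subset by auto
  have "card (X \<inter> Y) \<le> card (X \<union> Y)" using fin by (intro card_mono) auto
  then have ge: "d \<le> card (X \<union> Y)" using le by linarith
  let ?i = "\<lambda>X. int (induced_edge_count F X)" and ?b = "int ((d + 1) choose 2)"
  have "?i (X \<union> Y) \<le> int d * int (card (X \<union> Y)) - ?b" "?i (X \<inter> Y) \<le> int d * int (card (X \<inter> Y)) - ?b"
    using sp V ge le unfolding sparse_def by blast+
  moreover have "?i X = int d * int (card X) - ?b" "?i Y = int d * int (card Y) - ?b"
    using X Y by (auto simp: critical_sets_def)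
  moreover have "?i X + ?i Y \<le> ?i (X \<union> Y) + ?i (X \<inter> Y)"
    using induced_edge_count_supermodular[OF fF, of X Y] by linarith
  moreover have "int d * int (card X) + int d * int (card Y)
      = int d * int (card (X \<union> Y)) + int d * int (card (X \<inter> Y))"
    using card_Un_Int[OF fin] by (metis distrib_left of_nat_add)
  ultimately have "?i (X \<union> Y) = int d * int (card (X \<union> Y)) - ?b" by linarith
  then show ?thesis using V ge by (simp add: critical_sets_def)
qed

text \<open>Two distinct maximal critical sets meeting in d or more vertices would have a critical
  union, against maximality.\<close>

lemma maximal_critical_sets_family:
  assumes d: "1 \<le> d" "d \<le> 5" and fV: "finite V" and graph: "simple_graph V F" and sp: "sparse d V F"
  shows "critical_family d V F {X \<in> critical_sets d V F. \<forall>Y\<in>critical_sets d V F. X \<subseteq> Y \<longrightarrow> Y = X}"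
    (is "critical_family d V F ?M")
proof
  have fF: "finite F"
    by (rule finite_subset[of _ "Pow V"]) (use graph fV in \<open>auto simp: simple_graph_def\<close>)
  show "card (X \<inter> Y) < d" if X: "X \<in> ?M" and Y: "Y \<in> ?M" and "X \<noteq> Y" for X Y
  proof (rule ccontr)
    assume "\<not> card (X \<inter> Y) < d"
    then have "X \<union> Y \<in> critical_sets d V F" using critical_sets_Un[OF fV fF sp] X Y by simp
    then have "X \<union> Y = X" "X \<union> Y = Y" using X Y by blast+
    then show False using \<open>X \<noteq> Y\<close> by blast
  qed
qed (use assms in \<open>auto simp: critical_sets_def\<close>)

text \<open>Adding \<open>e\<close> raises the edge count of a set by at most one, and only if the
  set contains \<open>e\<close>; a set violating the bound afterwards was tight before.\<close>

lemma maximal_sparse_critical: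
  assumes fV: "finite V" and graph: "simple_graph V E" and max: "maximal_sparse_subgraph d V E F"
    and e: "e \<in> E" "e \<notin> F"
  shows "\<exists>X\<in>critical_sets d V F. e \<subseteq> X"
proof -
  have "F \<subseteq> E" and sp: "sparse d V F" and "\<not> sparse d V (insert e F)"
    using max e by (auto simp: maximal_sparse_subgraph_def)
  then obtain X where X: "X \<subseteq> V" "d \<le> card X"
      "int (induced_edge_count (insert e F) X) > int d * int (card X) - int ((d + 1) choose 2)"
    unfolding sparse_def not_le[symmetric] by blast
  have fF: "finite F"
    by (rule finite_subset[of _ "Pow V"]) (use graph fV \<open>F \<subseteq> E\<close> in \<open>auto simp: simple_graph_def\<close>)
  have le: "int (induced_edge_count F X) \<le> int d * int (card X) - int ((d + 1) choose 2)"
    using sp X by (auto simp: sparse_def)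
  have "{f \<in> insert e F. f \<subseteq> X} = (if e \<subseteq> X then insert e {f \<in> F. f \<subseteq> X} else {f \<in> F. f \<subseteq> X})" by auto
  then have "induced_edge_count (insert e F) X = (if e \<subseteq> X then 1 else 0) + induced_edge_count F X"
    using fF e(2) by (simp add: induced_edge_count_def)
  then have "e \<subseteq> X" "int (induced_edge_count F X) = int d * int (card X) - int ((d + 1) choose 2)"
    using X(3) le by (auto split: if_splits)
  then show ?thesis using X by (auto simp: critical_sets_def)
qed

theorem theorem4p1:
  fixes d :: nat and V :: "'a set" and E F :: "'a set set"
  assumes "1 \<le> d" and "d \<le> 5"
    and "finite V" and "simple_graph V E"
    and "maximal_sparse_subgraph d V E F"
  shows "rigidity_rank d V E \<le> card F"
proof -
  have FE: "F \<subseteq> E" and sp: "sparse d V F" using assms(5) by (auto simp: maximal_sparse_subgraph_def)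
  have graphF: "simple_graph V F" using assms(4) FE by (auto simp: simple_graph_def)
  have fE: "finite E"
    by (rule finite_subset[of _ "Pow V"]) (use assms(3,4) in \<open>auto simp: simple_graph_def\<close>)
  have fF: "finite F" using FE fE by (rule finite_subset)
  let ?C = "critical_sets d V F"
  define \<X> where "\<X> = {X \<in> ?C. \<forall>Y\<in>?C. X \<subseteq> Y \<longrightarrow> Y = X}"
  have fC: "finite ?C"
    by (rule finite_subset[of _ "Pow V"]) (use assms(3) in \<open>auto simp: critical_sets_def\<close>)
  have cover: "\<exists>X\<in>\<X>. e \<subseteq> X" if e: "e \<in> E" "e \<notin> F" for e
  proof -
    obtain X where X: "X \<in> ?C" "e \<subseteq> X" using maximal_sparse_critical[OF assms(3-5) e] by blast
    obtain M where "M \<in> ?C" "X \<subseteq> M" "\<forall>Y\<in>?C. M \<subseteq> Y \<longrightarrow> M = Y"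
      using finite_has_maximal2[OF fC X(1)] by blast
    then show ?thesis using X(2) by (intro bexI[of _ M]) (auto simp: \<X>_def)
  qed
  have fam: "critical_family d V F \<X>"
    unfolding \<X>_def by (rule maximal_critical_sets_family[OF assms(1-3) graphF sp])
  obtain p\<^sub>0 where p0: "framework_rank d V E p\<^sub>0 = rigidity_rank d V E"
    using rigidity_rank_attained[OF assms(3,4)] by blast
  obtain B where B: "B \<subseteq> edge_row d V p\<^sub>0 ` E" "fun_space.independent B"
      "edge_row d V p\<^sub>0 ` E \<subseteq> fun_space.span B" "card B = fun_space.dim (edge_row d V p\<^sub>0 ` E)"
    by (rule fun_space.basis_exists)
  obtain E\<^sub>0 where E0: "E\<^sub>0 \<subseteq> E" "inj_on (edge_row d V p\<^sub>0) E\<^sub>0" "B = edge_row d V p\<^sub>0 ` E\<^sub>0"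
    using B(1) unfolding subset_image_inj by blast
  have fE0: "finite E\<^sub>0" using E0(1) fE by (rule finite_subset)
  have cE0: "card E\<^sub>0 = rigidity_rank d V E"
    using B(4) E0(2,3) p0 by (simp add: card_image framework_rank_def matrix_rank_def)
  have "lin_indep E\<^sub>0 (edge_row d V p\<^sub>0)" using lin_indep_iff[OF fE0, of "edge_row d V p\<^sub>0"] E0(2,3) B(2) by simp
  \<comment> \<open>Only the independence of a row basis \<open>E\<^sub>0\<close> of an optimal
    framework has to survive the move to general position.\<close>
  then obtain p where p: "general_position d p V" "lin_indep E\<^sub>0 (edge_row d V p)"
    using exists_general_position[OF assms(3) fE0, of d p\<^sub>0] by auto
  obtain T where T: "finite T" "card T \<le> card {e \<in> F. \<exists>X\<in>\<X>. e \<subseteq> X}"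
      "\<And>X e. X \<in> \<X> \<Longrightarrow> e \<subseteq> X \<Longrightarrow> card e = 2 \<Longrightarrow> edge_row d V p e \<in> fun_space.span T"
    using critical_family_spanned[OF fam p(1)] by blast
  \<comment> \<open>Edges of \<open>F\<close> in no maximal critical set keep one vector each; by
    \<open>cover\<close>, all other edges of \<open>E\<close> lie inside a member.\<close>
  define R where "R = {e \<in> F. \<not> (\<exists>X\<in>\<X>. e \<subseteq> X)}"
  define T' where "T' = T \<union> edge_row d V p ` R"
  have fR: "finite R" using fF by (simp add: R_def)
  have "edge_row d V p e \<in> fun_space.span T'" if e: "e \<in> E" for e
  proof (cases "e \<in> R")
    case True
    then show ?thesis by (intro fun_space.span_base) (simp add: T'_def)
  next
    case False
    then obtain X where "X \<in> \<X>" "e \<subseteq> X" using cover e by (auto simp: R_def)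
    moreover have "card e = 2" using assms(4) e by (auto simp: simple_graph_def)
    ultimately have "edge_row d V p e \<in> fun_space.span T" by (rule T(3))
    moreover have "fun_space.span T \<subseteq> fun_space.span T'" by (rule fun_space.span_mono) (simp add: T'_def)
    ultimately show ?thesis by blast
  qed
  then have "card E\<^sub>0 \<le> card T'"
    using E0(1) T(1) fR by (intro card_le_if_lin_indep[OF fE0 p(2)]) (auto simp: T'_def)
  also have "\<dots> \<le> card T + card (edge_row d V p ` R)" unfolding T'_def by (rule card_Un_le)
  also have "\<dots> \<le> card {e \<in> F. \<exists>X\<in>\<X>. e \<subseteq> X} + card R"
    using T(2) card_image_le[OF fR] by (rule add_mono)
  also have "\<dots> = card ({e \<in> F. \<exists>X\<in>\<X>. e \<subseteq> X} \<union> R)"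
    using fF fR by (intro card_Un_disjoint[symmetric]) (auto simp: R_def)
  also have "{e \<in> F. \<exists>X\<in>\<X>. e \<subseteq> X} \<union> R = F" by (auto simp: R_def)
  finally show ?thesis using cE0 by simp
qed

end
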